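(* Let $\Omega=(0,1)\times\mathbb{T}^2$. Then $$\|\zeta\|_{L^{2}(\Omega)}^{2}\leq\|\nabla\zeta\|_{L^{2}(\Omega)}^{2}+\|\zeta\|_{L^{2}(\partial\Omega)}^{2}$$ for all $\zeta\in H^{1}(\Omega)$.
   Context: $\partial\Omega=\{0,1\}\times\mathbb{T}^2$, and the boundary norm is that of the trace of $\zeta$ on both components of $\partial\Omega$. *)

theory Defs
  imports "HOL-Analysis.Analysis"
begin

text \<open>
  The torus is the flat torus of arbitrary side length \<open>L > 0\<close> (so the conventions
  \<open>L = 1\<close> and \<open>L = 2 * pi\<close> are both covered). A function on \<open>(0,1) \<times> T\<^sup>2\<close>, on its
  closure or on its boundary is represented by a function of three real variables that is
  \<open>L\<close>-periodic in the last two; integrals over the torus are taken over the period cell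
  \<open>[0,L) \<times> [0,L)\<close>, and values of the first variable outside the set in question are irrelevant.
\<close>

type_synonym point = "real \<times> real \<times> real"

definition torus_periodic :: "real \<Rightarrow> (point \<Rightarrow> 'b) \<Rightarrow> bool" where
  "torus_periodic L f \<longleftrightarrow>
     (\<forall>x y z. f (x, y + L, z) = f (x, y, z) \<and> f (x, y, z + L) = f (x, y, z))"

definition slab :: "real \<Rightarrow> point measure" where
  "slab L = restrict_space lborel ({0<..<1} \<times> {0..<L} \<times> {0..<L})"

definition slab_boundary :: "real \<Rightarrow> point measure" where
  "slab_boundary L = count_space {0, 1} \<Otimes>\<^sub>M restrict_space lborel ({0..<L} \<times> {0..<L})"

definition L2 :: "'a measure \<Rightarrow> ('a \<Rightarrow> 'b::euclidean_space) set" where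
  "L2 M = {f. f \<in> borel_measurable M \<and> integrable M (\<lambda>x. (norm (f x))\<^sup>2)}"

text \<open>Only meaningful on \<^const>\<open>L2\<close>: the Bochner integral of a non-integrable function is \<open>0\<close>.\<close>

definition L2_norm :: "'a measure \<Rightarrow> ('a \<Rightarrow> 'b::euclidean_space) \<Rightarrow> real" where
  "L2_norm M f = sqrt (\<integral>x. (norm (f x))\<^sup>2 \<partial>M)"

definition partial_deriv :: "'a::euclidean_space \<Rightarrow> ('a \<Rightarrow> real) \<Rightarrow> 'a \<Rightarrow> real" where
  "partial_deriv b f x = frechet_derivative f (at x) b"

definition gradient :: "('a::euclidean_space \<Rightarrow> real) \<Rightarrow> 'a \<Rightarrow> 'a" where
  "gradient f x = (\<Sum>b\<in>Basis. partial_deriv b f x *\<^sub>R b)"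

primrec C_k :: "nat \<Rightarrow> ('a::euclidean_space \<Rightarrow> real) \<Rightarrow> bool" where
  "C_k 0 f \<longleftrightarrow> continuous_on UNIV f"
| "C_k (Suc k) f \<longleftrightarrow> f differentiable_on UNIV \<and> (\<forall>b\<in>Basis. C_k k (partial_deriv b f))"

definition smooth :: "('a::euclidean_space \<Rightarrow> real) \<Rightarrow> bool" where
  "smooth f \<longleftrightarrow> (\<forall>k. C_k k f)"

text \<open>Smooth functions with compact support in \<open>(0,1) \<times> T\<^sup>2\<close>, extended by zero.\<close>

definition test_functions :: "real \<Rightarrow> (point \<Rightarrow> real) set" where
  "test_functions L = {\<phi>. smooth \<phi> \<and> torus_periodic L \<phi> \<and>
     (\<exists>a b. 0 < a \<and> b < 1 \<and> (\<forall>x. \<phi> x \<noteq> 0 \<longrightarrow> fst x \<in> {a..b}))}"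

definition is_weak_gradient :: "real \<Rightarrow> (point \<Rightarrow> real) \<Rightarrow> (point \<Rightarrow> point) \<Rightarrow> bool" where
  "is_weak_gradient L \<zeta> G \<longleftrightarrow> torus_periodic L G \<and> G \<in> L2 (slab L) \<and>
     (\<forall>\<phi>\<in>test_functions L. \<forall>b\<in>Basis.
        (\<integral>x. \<zeta> x * partial_deriv b \<phi> x \<partial>slab L) = - (\<integral>x. (G x \<bullet> b) * \<phi> x \<partial>slab L))"

definition H1 :: "real \<Rightarrow> (point \<Rightarrow> real) set" where
  "H1 L = {\<zeta>. torus_periodic L \<zeta> \<and> \<zeta> \<in> L2 (slab L) \<and> (\<exists>G. is_weak_gradient L \<zeta> G)}"

text \<open>Weak gradients are unique up to null sets, so the choice does not affect norms.\<close>

definition weak_gradient :: "real \<Rightarrow> (point \<Rightarrow> real) \<Rightarrow> point \<Rightarrow> point" where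
  "weak_gradient L \<zeta> = (SOME G. is_weak_gradient L \<zeta> G)"

text \<open>
  The trace operator is the continuous extension to \<^const>\<open>H1\<close> of the restriction
  \<open>u \<mapsto> u\<close> on the boundary, for \<open>u\<close> smooth up to the boundary: the trace of \<open>\<zeta>\<close> is the limit
  in \<open>L\<^sup>2\<close> of the boundary of the boundary values of smooth functions converging to \<open>\<zeta>\<close> in
  \<^const>\<open>H1\<close>. It is again determined up to null sets.
\<close>

definition is_trace :: "real \<Rightarrow> (point \<Rightarrow> real) \<Rightarrow> (point \<Rightarrow> real) \<Rightarrow> bool" where
  "is_trace L \<zeta> \<tau> \<longleftrightarrow> torus_periodic L \<tau> \<and> \<tau> \<in> L2 (slab_boundary L) \<and>
     (\<exists>u :: nat \<Rightarrow> point \<Rightarrow> real.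
        (\<forall>n. smooth (u n) \<and> torus_periodic L (u n)) \<and>
        (\<lambda>n. L2_norm (slab L) (\<lambda>x. u n x - \<zeta> x)) \<longlonglongrightarrow> 0 \<and>
        (\<lambda>n. L2_norm (slab L) (\<lambda>x. gradient (u n) x - weak_gradient L \<zeta> x)) \<longlonglongrightarrow> 0 \<and>
        (\<lambda>n. L2_norm (slab_boundary L) (\<lambda>x. u n x - \<tau> x)) \<longlonglongrightarrow> 0)"

definition boundary_trace :: "real \<Rightarrow> (point \<Rightarrow> real) \<Rightarrow> point \<Rightarrow> real" where
  "boundary_trace L \<zeta> = (SOME \<tau>. is_trace L \<zeta> \<tau>)"

end

theory Submission
  imports Defs
begin

text \<open>
  For a smooth function \<open>u\<close> the inequality comes from integrating the normal derivative of
  \<open>(x - 1 / 2) u\<^sup>2\<close> over the slab: the boundary contributes half of the boundary norm, the derivative of the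
  weight contributes \<open>\<integral> u\<^sup>2\<close>, and the mixed term is absorbed by Young's inequality (\<open>poincare_smooth\<close>). Both
  sides are continuous for the convergences that define the trace, so the inequality passes to \<open>\<zeta>\<close>
  along any approximating sequence. What has to be shown is that such a sequence exists: that functions
  smooth up to the boundary are dense in \<^const>\<open>H1\<close>, and that their boundary values converge.

  Density is proved by Fourier expansion, with cosines in the normal variable and the real family
  \<open>cas t = cos t + sin t\<close> in the two periodic ones. Partial sums of the expansion of \<open>\<zeta>\<close> are smooth. The normal
  derivative of such a sum is a combination of sine modes, a tangential derivative one of cosine modes, and
  integration by parts against the weak gradient \<open>G\<close> shows that the coefficients are those of the expansion of
  the corresponding component of \<open>G\<close> (\<open>smooth_approximation\<close>). Two facts enter. The modes are not compactly
  supported in the open slab, so the weak formulation has to be extended to them by cutoffs; the cutoff error vanishes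
  because the modes paired with the normal derivative contain a factor \<open>sin (k \<pi> x)\<close> that is zero on the boundary
  (\<open>weak_gradient_by_parts\<close>). And each family of modes spans a dense subspace of \<open>L\<^sup>2\<close>: combinations of
  cosine modes are exactly the polynomials in five trigonometric coordinates that embed the slab in a compact set, so
  Stone--Weierstrass applies (\<open>cosine_modes_dense\<close>), and multiplication by \<open>sin (\<pi> x)\<close> carries the
  statement over to sine modes (\<open>sine_modes_dense\<close>).

  The trace can be written down: for \<open>x \<in> {0, 1}\<close> it is \<open>\<integral> \<zeta> (s, w) + (s + x - 1) G\<^sub>1 (s, w) ds\<close>, which
  for smooth functions is the fundamental theorem of calculus. By Jensen's inequality this expression is bounded
  from \<open>L\<^sup>2\<close> of the slab to \<open>L\<^sup>2\<close> of the boundary, which gives the convergence of the boundary values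
  (\<open>trace_exists\<close>).
\<close>


section \<open>The seminorm of square-integrable functions\<close>

lemma L2_D:
  assumes "f \<in> L2 M"
  shows "f \<in> borel_measurable M" "integrable M (\<lambda>x. (norm (f x))\<^sup>2)"
  using assms by (auto simp: L2_def)

lemma L2_norm_nonneg: "0 \<le> L2_norm M f"
  by (simp add: L2_norm_def)

lemma L2_norm_sq: "(L2_norm M f)\<^sup>2 = (\<integral>x. (norm (f x))\<^sup>2 \<partial>M)"
  by (simp add: L2_norm_def)

lemma L2_dominated:
  fixes f :: "'a \<Rightarrow> 'b::euclidean_space" and g :: "'a \<Rightarrow> 'c::euclidean_space"
  assumes f: "f \<in> L2 M" and [measurable]: "g \<in> borel_measurable M"
    and B: "AE x in M. norm (g x) \<le> B * norm (f x)"
  shows "g \<in> L2 M"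
proof -
  note [measurable] = L2_D(1)[OF f]
  have "integrable M (\<lambda>x. (norm (g x))\<^sup>2)"
  proof (rule Bochner_Integration.integrable_bound)
    show "integrable M (\<lambda>x. B\<^sup>2 * (norm (f x))\<^sup>2)"
      using L2_D(2)[OF f] by simp
    show "AE x in M. norm ((norm (g x))\<^sup>2) \<le> norm (B\<^sup>2 * (norm (f x))\<^sup>2)"
      using B
    proof eventually_elim
      case (elim x)
      then have "(norm (g x))\<^sup>2 \<le> (B * norm (f x))\<^sup>2"
        by (intro power_mono) auto
      then show "norm ((norm (g x))\<^sup>2) \<le> norm (B\<^sup>2 * (norm (f x))\<^sup>2)"
        by (simp add: power_mult_distrib)
    qed
  qed simp
  then show ?thesis by (simp add: L2_def)
qed

lemma L2_const: "finite_measure M \<Longrightarrow> (\<lambda>_. c) \<in> L2 M"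
  by (simp add: L2_def finite_measure.integrable_const)

lemma L2_bounded:
  fixes f :: "'a \<Rightarrow> 'b::euclidean_space"
  assumes "finite_measure M" and "f \<in> borel_measurable M" and "AE x in M. norm (f x) \<le> B"
  shows "f \<in> L2 M"
  by (rule L2_dominated[OF L2_const[of M "1::real"], of _ B]) (use assms in auto)

lemma L2_scale: "f \<in> L2 M \<Longrightarrow> (\<lambda>x. (c::real) *\<^sub>R f x) \<in> L2 M"
  by (rule L2_dominated[of f _ _ "\<bar>c\<bar>"]) (auto dest: L2_D)

lemma L2_cmult: "f \<in> L2 M \<Longrightarrow> (\<lambda>x. (c::real) * f x) \<in> L2 M"
  using L2_scale[of f M c] by simp

text \<open>Young's inequality in the weighted form that, optimised over \<open>t\<close>, is Minkowski's inequality.\<close>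

lemma norm_add_sq_le:
  fixes a b :: "'a::real_normed_vector" and t :: real
  assumes "0 < t"
  shows "(norm (a + b))\<^sup>2 \<le> (1 + t) * (norm a)\<^sup>2 + (1 + 1 / t) * (norm b)\<^sup>2"
proof -
  have "(norm (a + b))\<^sup>2 \<le> (norm a + norm b)\<^sup>2"
    by (intro power_mono norm_triangle_ineq) simp
  also have "\<dots> \<le> (norm a + norm b)\<^sup>2 + (t * norm a - norm b)\<^sup>2 / t"
    using assms by simp
  also have "\<dots> = (1 + t) * (norm a)\<^sup>2 + (1 + 1 / t) * (norm b)\<^sup>2"
    using assms by (simp add: power2_eq_square field_simps)
  finally show ?thesis .
qed

lemma L2_add:
  assumes f: "f \<in> L2 M" and g: "g \<in> L2 M"
  shows "(\<lambda>x. f x + g x) \<in> L2 M"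
proof -
  note [measurable] = L2_D(1)[OF f] L2_D(1)[OF g]
  have "integrable M (\<lambda>x. (norm (f x + g x))\<^sup>2)"
  proof (rule Bochner_Integration.integrable_bound)
    show "integrable M (\<lambda>x. (1 + 1) * (norm (f x))\<^sup>2 + (1 + 1 / 1) * (norm (g x))\<^sup>2)"
      using L2_D(2)[OF f] L2_D(2)[OF g] by simp
    show "AE x in M. norm ((norm (f x + g x))\<^sup>2)
        \<le> norm ((1 + 1) * (norm (f x))\<^sup>2 + (1 + 1 / 1) * (norm (g x))\<^sup>2)"
      using norm_add_sq_le[of 1 "f _" "g _"] by (auto intro!: AE_I2)
  qed simp
  then show ?thesis by (simp add: L2_def)
qed

lemma L2_diff: "f \<in> L2 M \<Longrightarrow> g \<in> L2 M \<Longrightarrow> (\<lambda>x. f x - g x) \<in> L2 M"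
  using L2_add[of f M "\<lambda>x. (-1) *\<^sub>R g x"] L2_scale[of g M "-1"] by simp

lemma L2_sum: "(\<And>i. i \<in> F \<Longrightarrow> f i \<in> L2 M) \<Longrightarrow> (\<lambda>x. \<Sum>i\<in>F. f i x) \<in> L2 M"
proof (induction F rule: infinite_finite_induct)
  case (insert i F)
  then show ?case using L2_add[of "f i" M "\<lambda>x. \<Sum>i\<in>F. f i x"] by auto
qed (auto simp: L2_def)

lemma L2_triangle:
  assumes f: "f \<in> L2 M" and g: "g \<in> L2 M"
  shows "L2_norm M (\<lambda>x. f x + g x) \<le> L2_norm M f + L2_norm M g"
proof (rule field_le_epsilon)
  fix e :: real assume e: "0 < e"
  define a b where "a = L2_norm M f + e / 2" and "b = L2_norm M g + e / 2"
  have ab: "a > 0" "b > 0" "L2_norm M f \<le> a" "L2_norm M g \<le> b"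
    using e L2_norm_nonneg[of M f] L2_norm_nonneg[of M g] by (auto simp: a_def b_def)
  note I = L2_D(2)[OF f] L2_D(2)[OF g] L2_D(2)[OF L2_add[OF f g]]
  \<comment> \<open>The weight \<open>b / a\<close> is the minimiser; \<open>a\<close> and \<open>b\<close> exceed the norms so that it is defined and positive.\<close>
  have "(L2_norm M (\<lambda>x. f x + g x))\<^sup>2
      \<le> (\<integral>x. (1 + b / a) * (norm (f x))\<^sup>2 + (1 + 1 / (b / a)) * (norm (g x))\<^sup>2 \<partial>M)"
    unfolding L2_norm_sq using I ab
    by (intro integral_mono norm_add_sq_le) auto
  also have "\<dots> = (1 + b / a) * (L2_norm M f)\<^sup>2 + (1 + a / b) * (L2_norm M g)\<^sup>2"
    unfolding L2_norm_sq using I by simp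
  also have "\<dots> \<le> (1 + b / a) * a\<^sup>2 + (1 + a / b) * b\<^sup>2"
    using ab L2_norm_nonneg by (intro add_mono mult_left_mono power_mono) auto
  also have "\<dots> = (a + b)\<^sup>2"
    using ab by (simp add: power2_eq_square field_simps)
  finally have "L2_norm M (\<lambda>x. f x + g x) \<le> a + b"
    by (rule power2_le_imp_le) (use ab in auto)
  then show "L2_norm M (\<lambda>x. f x + g x) \<le> L2_norm M f + L2_norm M g + e"
    by (simp add: a_def b_def)
qed

lemma L2_norm_minus: "L2_norm M (\<lambda>x. f x - g x) = L2_norm M (\<lambda>x. g x - f x)"
  by (simp add: L2_norm_def norm_minus_commute)

lemma L2_norm_scale: "L2_norm M (\<lambda>x. (c::real) *\<^sub>R f x) = \<bar>c\<bar> * L2_norm M f"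
  by (simp add: L2_norm_def power_mult_distrib real_sqrt_mult)

lemma L2_triangle_diff:
  assumes "f \<in> L2 M" and "g \<in> L2 M" and "h \<in> L2 M"
  shows "L2_norm M (\<lambda>x. f x - h x) \<le> L2_norm M (\<lambda>x. f x - g x) + L2_norm M (\<lambda>x. g x - h x)"
  using L2_triangle[of "\<lambda>x. f x - g x" M "\<lambda>x. g x - h x"] assms by (simp add: L2_diff)

lemma L2_norm_mono:
  fixes f :: "'a \<Rightarrow> 'b::euclidean_space" and g :: "'a \<Rightarrow> 'c::euclidean_space"
  assumes "f \<in> L2 M" "g \<in> L2 M" "AE x in M. norm (f x) \<le> norm (g x)"
  shows "L2_norm M f \<le> L2_norm M g"
  unfolding L2_norm_def using assms
  by (intro real_sqrt_le_mono integral_mono_AE) (auto dest: L2_D)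

lemma L2_norm_bounded:
  fixes f :: "'a \<Rightarrow> 'b::euclidean_space"
  assumes "finite_measure M" and f: "f \<in> borel_measurable M"
    and B: "AE x in M. norm (f x) \<le> B" and "0 \<le> B"
  shows "L2_norm M f \<le> B * sqrt (measure M (space M))"
proof -
  interpret finite_measure M by fact
  have "L2_norm M f \<le> L2_norm M (\<lambda>_. B)"
    using assms by (intro L2_norm_mono L2_const L2_bounded[of M f B]) auto
  also have "\<dots> = B * sqrt (measure M (space M))"
    using \<open>0 \<le> B\<close> by (simp add: L2_norm_def real_sqrt_mult)
  finally show ?thesis .
qed

lemma L2_dominated_convergence:
  fixes f :: "'a \<Rightarrow> 'b::euclidean_space" and h :: "'a \<Rightarrow> real" and u :: "nat \<Rightarrow> 'a \<Rightarrow> 'b"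
  assumes h: "h \<in> L2 M" and f[measurable]: "f \<in> borel_measurable M"
    and u[measurable]: "\<And>n. u n \<in> borel_measurable M"
    and bound: "\<And>n x. x \<in> space M \<Longrightarrow> norm (u n x) \<le> h x"
    and lim: "\<And>x. x \<in> space M \<Longrightarrow> (\<lambda>n. u n x) \<longlonglongrightarrow> f x"
  shows "f \<in> L2 M" "\<And>n. u n \<in> L2 M" "(\<lambda>n. L2_norm M (\<lambda>x. f x - u n x)) \<longlonglongrightarrow> 0"
proof -
  have bf: "norm (f x) \<le> h x" if "x \<in> space M" for x
    using LIMSEQ_le_const2[OF tendsto_norm[OF lim[OF that]]] bound[OF that] by auto
  show "f \<in> L2 M" "u n \<in> L2 M" for n
    using order_trans[OF bf abs_ge_self] order_trans[OF bound abs_ge_self]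
    by (auto intro!: L2_dominated[OF h, of _ 1] AE_I2)
  have "(\<lambda>n. \<integral>x. (norm (f x - u n x))\<^sup>2 \<partial>M) \<longlonglongrightarrow> (\<integral>x. 0 \<partial>M)"
  proof (rule integral_dominated_convergence[where w = "\<lambda>x. 4 * (norm (h x))\<^sup>2"])
    show "integrable M (\<lambda>x. 4 * (norm (h x))\<^sup>2)"
      using L2_D(2)[OF h] by simp
    show "AE x in M. (\<lambda>n. (norm (f x - u n x))\<^sup>2) \<longlonglongrightarrow> 0"
    proof (rule AE_I2)
      fix x assume "x \<in> space M"
      then have "(\<lambda>n. (norm (f x - u n x))\<^sup>2) \<longlonglongrightarrow> (norm (f x - f x))\<^sup>2"
        by (intro tendsto_intros lim)
      then show "(\<lambda>n. (norm (f x - u n x))\<^sup>2) \<longlonglongrightarrow> 0" by simp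
    qed
    show "AE x in M. norm ((norm (f x - u n x))\<^sup>2) \<le> 4 * (norm (h x))\<^sup>2" for n
    proof (rule AE_I2)
      fix x assume x: "x \<in> space M"
      have "norm (f x - u n x) \<le> 2 * \<bar>h x\<bar>"
        using norm_triangle_ineq4[of "f x" "u n x"] bf[OF x] bound[OF x, of n] by linarith
      then have "(norm (f x - u n x))\<^sup>2 \<le> (2 * \<bar>h x\<bar>)\<^sup>2"
        by (rule power_mono) simp
      then show "norm ((norm (f x - u n x))\<^sup>2) \<le> 4 * (norm (h x))\<^sup>2"
        by (simp add: power_mult_distrib)
    qed
  qed auto
  then have "(\<lambda>n. sqrt (\<integral>x. (norm (f x - u n x))\<^sup>2 \<partial>M)) \<longlonglongrightarrow> sqrt 0"
    by (intro tendsto_real_sqrt) simp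
  then show "(\<lambda>n. L2_norm M (\<lambda>x. f x - u n x)) \<longlonglongrightarrow> 0"
    by (simp add: L2_norm_def)
qed

lemma L2_norm_tendsto:
  assumes u: "\<And>n::nat. u n \<in> L2 M" and f: "f \<in> L2 M"
    and lim: "(\<lambda>n. L2_norm M (\<lambda>x. u n x - f x)) \<longlonglongrightarrow> 0"
  shows "(\<lambda>n. L2_norm M (u n)) \<longlonglongrightarrow> L2_norm M f"
proof (rule LIM_zero_cancel, rule Lim_null_comparison[OF _ lim])
  show "\<forall>\<^sub>F n in sequentially. norm (L2_norm M (u n) - L2_norm M f) \<le> L2_norm M (\<lambda>x. u n x - f x)"
  proof (rule always_eventually, rule allI)
    fix n
    have "L2_norm M (u n) \<le> L2_norm M (\<lambda>x. u n x - f x) + L2_norm M f"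
      using L2_triangle[of "\<lambda>x. u n x - f x" M f] u f by (simp add: L2_diff)
    moreover have "L2_norm M f \<le> L2_norm M (\<lambda>x. u n x - f x) + L2_norm M (u n)"
      using L2_triangle[of "\<lambda>x. f x - u n x" M "u n"] u f L2_norm_minus[of M "u n" f]
      by (simp add: L2_diff)
    ultimately show "norm (L2_norm M (u n) - L2_norm M f) \<le> L2_norm M (\<lambda>x. u n x - f x)"
      by (simp add: abs_le_iff)
  qed
qed

lemma L2_mult_integrable:
  fixes f g :: "'a \<Rightarrow> real"
  assumes f: "f \<in> L2 M" and g: "g \<in> L2 M"
  shows "integrable M (\<lambda>x. f x * g x)"
proof (rule Bochner_Integration.integrable_bound)
  show "integrable M (\<lambda>x. (norm (f x))\<^sup>2 + (norm (g x))\<^sup>2)"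
    using L2_D(2)[OF f] L2_D(2)[OF g] by (rule Bochner_Integration.integrable_add)
  show "(\<lambda>x. f x * g x) \<in> borel_measurable M"
    using L2_D(1)[OF f] L2_D(1)[OF g] by (rule borel_measurable_times)
  show "AE x in M. norm (f x * g x) \<le> norm ((norm (f x))\<^sup>2 + (norm (g x))\<^sup>2)"
  proof (rule AE_I2)
    fix x
    have "2 * \<bar>f x\<bar> * \<bar>g x\<bar> \<le> \<bar>f x\<bar>\<^sup>2 + \<bar>g x\<bar>\<^sup>2" by (rule sum_squares_bound)
    moreover have "0 \<le> \<bar>f x\<bar> * \<bar>g x\<bar>" by simp
    ultimately show "norm (f x * g x) \<le> norm ((norm (f x))\<^sup>2 + (norm (g x))\<^sup>2)"
      by (simp only: real_norm_def abs_mult) linarith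
  qed
qed

lemma L2_integrable:
  fixes f :: "'a \<Rightarrow> real"
  assumes "finite_measure M" "f \<in> L2 M"
  shows "integrable M f"
  using L2_mult_integrable[OF assms(2) L2_const[OF assms(1), of 1]] by simp

lemma L2_component: "f \<in> L2 M \<Longrightarrow> (\<lambda>x. f x \<bullet> b) \<in> L2 M"
  by (rule L2_dominated[of f _ _ "norm b"])
     (auto dest!: L2_D(1) intro!: AE_I2 simp: Cauchy_Schwarz_ineq2 mult.commute[of "norm b"])

lemma L2_norm_sq_components:
  fixes f :: "'a \<Rightarrow> 'b::euclidean_space"
  assumes "f \<in> L2 M"
  shows "(L2_norm M f)\<^sup>2 = (\<Sum>b\<in>Basis. (L2_norm M (\<lambda>x. f x \<bullet> b))\<^sup>2)"
proof -
  have "(norm v)\<^sup>2 = (\<Sum>b\<in>Basis. (norm (v \<bullet> b))\<^sup>2)" for v :: 'b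
    by (subst power2_norm_eq_inner, subst euclidean_inner) (simp add: power2_eq_square)
  then show ?thesis
    unfolding L2_norm_sq using L2_D(2)[OF L2_component[OF assms]]
    by (simp del: real_norm_def)
qed

text \<open>The Pythagorean theorem: the combination whose coefficients match the inner products of
  \<open>f\<close> with an orthogonal system differs from \<open>f\<close> by a function orthogonal to the system,
  so no combination of the same members is closer. The coefficient of a member of norm \<open>0\<close> is arbitrary; the sine
  modes of frequency \<open>0\<close> are of this kind.\<close>

lemma orthogonal_best_approximation:
  fixes e :: "'i \<Rightarrow> 'a \<Rightarrow> real"
  assumes F: "finite F" and e: "\<And>i. i \<in> F \<Longrightarrow> e i \<in> L2 M" and f: "f \<in> L2 M"
    and orth: "\<And>i j. i \<in> F \<Longrightarrow> j \<in> F \<Longrightarrow> i \<noteq> j \<Longrightarrow> (\<integral>x. e i x * e j x \<partial>M) = 0"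
    and c: "\<And>i. i \<in> F \<Longrightarrow> (\<integral>x. f x * e i x \<partial>M) = c i * (\<integral>x. e i x * e i x \<partial>M)"
  shows "L2_norm M (\<lambda>x. f x - (\<Sum>i\<in>F. c i * e i x)) \<le> L2_norm M (\<lambda>x. f x - (\<Sum>i\<in>F. a i * e i x))"
proof -
  define r where "r x = f x - (\<Sum>i\<in>F. c i * e i x)" for x
  define s where "s x = (\<Sum>i\<in>F. (c i - a i) * e i x)" for x
  have S: "(\<lambda>x. \<Sum>i\<in>F. d i * e i x) \<in> L2 M" for d
    by (intro L2_sum L2_cmult e)
  have r: "r \<in> L2 M" and s: "s \<in> L2 M"
    unfolding r_def s_def by (intro L2_diff f S)+
  have "(\<integral>x. r x * e i x \<partial>M) = 0" if i: "i \<in> F" for i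
  proof -
    have ie: "integrable M (\<lambda>x. c j * (e j x * e i x))" if "j \<in> F" for j
      using L2_mult_integrable[OF e e] that i by auto
    have "(\<integral>x. r x * e i x \<partial>M) = (\<integral>x. f x * e i x - (\<Sum>j\<in>F. c j * (e j x * e i x)) \<partial>M)"
      by (simp add: r_def algebra_simps sum_distrib_left)
    also have "\<dots> = (\<integral>x. f x * e i x \<partial>M) - (\<Sum>j\<in>F. c j * (\<integral>x. e j x * e i x \<partial>M))"
      using ie L2_mult_integrable[OF f e[OF i]] by (simp add: Bochner_Integration.integral_diff)
    also have "(\<Sum>j\<in>F. c j * (\<integral>x. e j x * e i x \<partial>M)) = (\<Sum>j\<in>F. if j = i then c i * (\<integral>x. e i x * e i x \<partial>M) else 0)"
      using orth i by (intro sum.cong) auto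
    also have "\<dots> = c i * (\<integral>x. e i x * e i x \<partial>M)"
      using F i by simp
    finally show ?thesis using c[OF i] by simp
  qed
  moreover have "(\<integral>x. r x * s x \<partial>M) = (\<Sum>i\<in>F. (c i - a i) * (\<integral>x. r x * e i x \<partial>M))"
  proof -
    have "(\<integral>x. r x * s x \<partial>M) = (\<integral>x. (\<Sum>i\<in>F. (c i - a i) * (r x * e i x)) \<partial>M)"
      by (simp add: s_def sum_distrib_left algebra_simps)
    then show ?thesis
      using L2_mult_integrable[OF r e] by simp
  qed
  ultimately have rs: "(\<integral>x. r x * s x \<partial>M) = 0" by simp
  have "(L2_norm M r)\<^sup>2 \<le> (L2_norm M (\<lambda>x. r x + s x))\<^sup>2"
  proof -
    have "(\<lambda>x. (r x + s x)\<^sup>2) = (\<lambda>x. (r x)\<^sup>2 + 2 * (r x * s x) + (s x)\<^sup>2)"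
      by (auto simp: power2_eq_square algebra_simps)
    then show ?thesis
      using L2_D(2)[OF r] L2_D(2)[OF s] L2_mult_integrable[OF r s] rs by (simp add: L2_norm_sq)
  qed
  then have "L2_norm M r \<le> L2_norm M (\<lambda>x. r x + s x)"
    using L2_norm_nonneg by (rule power2_le_imp_le)
  also have "(\<lambda>x. r x + s x) = (\<lambda>x. f x - (\<Sum>i\<in>F. a i * e i x))"
    by (simp add: r_def s_def sum_subtractf algebra_simps fun_eq_iff)
  finally show ?thesis unfolding r_def .
qed

section \<open>Density of polynomials\<close>

text \<open>In this lemma and the next three, \<open>P\<close> singles out a class of approximating functions: the functions that the
  class approximates form a closed subspace as soon as the class is a subspace.\<close>

lemma L2_approx_closure:
  assumes f: "f \<in> L2 M" and P: "\<And>p. P p \<Longrightarrow> p \<in> L2 M"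
    and g: "\<And>e. 0 < e \<Longrightarrow> \<exists>g\<in>L2 M. L2_norm M (\<lambda>x. f x - g x) < e
              \<and> (\<forall>e>0. \<exists>p. P p \<and> L2_norm M (\<lambda>x. g x - p x) < e)"
    and "(0::real) < e"
  shows "\<exists>p. P p \<and> L2_norm M (\<lambda>x. f x - p x) < e"
proof -
  obtain g where g: "g \<in> L2 M" "L2_norm M (\<lambda>x. f x - g x) < e / 2"
    "\<forall>e>0. \<exists>p. P p \<and> L2_norm M (\<lambda>x. g x - p x) < e"
    using g[of "e / 2"] \<open>0 < e\<close> by auto
  then obtain p where p: "P p" "L2_norm M (\<lambda>x. g x - p x) < e / 2"
    using half_gt_zero[OF \<open>0 < e\<close>] by blast
  have "L2_norm M (\<lambda>x. f x - p x) \<le> L2_norm M (\<lambda>x. f x - g x) + L2_norm M (\<lambda>x. g x - p x)"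
    by (rule L2_triangle_diff[OF f g(1) P[OF p(1)]])
  with p g show ?thesis by (auto intro!: exI[of _ p])
qed

lemma L2_approx_limit:
  fixes u :: "nat \<Rightarrow> 'a \<Rightarrow> 'b::euclidean_space"
  assumes "\<And>n. u n \<in> L2 M" and "f \<in> L2 M" and P: "\<And>p. P p \<Longrightarrow> p \<in> L2 M"
    and lim: "(\<lambda>n. L2_norm M (\<lambda>x. f x - u n x)) \<longlonglongrightarrow> 0"
    and u: "\<And>n e. (0::real) < e \<Longrightarrow> \<exists>p. P p \<and> L2_norm M (\<lambda>x. u n x - p x) < e"
    and "(0::real) < e"
  shows "\<exists>p. P p \<and> L2_norm M (\<lambda>x. f x - p x) < e"
proof (rule L2_approx_closure[OF assms(2) P _ \<open>0 < e\<close>])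
  fix e :: real assume "0 < e"
  then have "\<forall>\<^sub>F n in sequentially. L2_norm M (\<lambda>x. f x - u n x) < e"
    using lim by (rule order_tendstoD[rotated])
  then obtain n where "L2_norm M (\<lambda>x. f x - u n x) < e"
    by (meson eventually_sequentially order_refl)
  then show "\<exists>g\<in>L2 M. L2_norm M (\<lambda>x. f x - g x) < e
              \<and> (\<forall>e>0. \<exists>p. P p \<and> L2_norm M (\<lambda>x. g x - p x) < e)"
    using assms(1) u by (intro bexI[of _ "u n"]) auto
qed

lemma L2_approx_add:
  assumes "f \<in> L2 M" "g \<in> L2 M" and P: "\<And>p. P p \<Longrightarrow> p \<in> L2 M"
    and add: "\<And>p q. P p \<Longrightarrow> P q \<Longrightarrow> P (\<lambda>x. p x + q x)"
    and f: "\<And>e. (0::real) < e \<Longrightarrow> \<exists>p. P p \<and> L2_norm M (\<lambda>x. f x - p x) < e"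
    and g: "\<And>e. (0::real) < e \<Longrightarrow> \<exists>p. P p \<and> L2_norm M (\<lambda>x. g x - p x) < e"
    and "(0::real) < e"
  shows "\<exists>p. P p \<and> L2_norm M (\<lambda>x. (f x + g x) - p x) < e"
proof -
  obtain p q where pq: "P p" "L2_norm M (\<lambda>x. f x - p x) < e / 2"
    "P q" "L2_norm M (\<lambda>x. g x - q x) < e / 2"
    using f[of "e / 2"] g[of "e / 2"] \<open>0 < e\<close> by auto
  have "L2_norm M (\<lambda>x. (f x - p x) + (g x - q x)) \<le> L2_norm M (\<lambda>x. f x - p x) + L2_norm M (\<lambda>x. g x - q x)"
    using assms pq by (intro L2_triangle L2_diff) auto
  then have "L2_norm M (\<lambda>x. (f x + g x) - (p x + q x)) < e"
    using pq by (simp add: algebra_simps)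
  then show ?thesis using add[OF pq(1,3)] by (intro exI[of _ "\<lambda>x. p x + q x"]) auto
qed

lemma L2_approx_scale:
  fixes f :: "'a \<Rightarrow> real"
  assumes scale: "\<And>p c. P p \<Longrightarrow> P (\<lambda>x. c * p x)"
    and f: "\<And>e. (0::real) < e \<Longrightarrow> \<exists>p. P p \<and> L2_norm M (\<lambda>x. f x - p x) < e"
    and "(0::real) < e"
  shows "\<exists>p. P p \<and> L2_norm M (\<lambda>x. c * f x - p x) < e"
proof -
  have "0 < e / (\<bar>c\<bar> + 1)" using \<open>0 < e\<close> by simp
  then obtain p where p: "P p" "L2_norm M (\<lambda>x. f x - p x) < e / (\<bar>c\<bar> + 1)"
    using f by blast
  have "L2_norm M (\<lambda>x. c * f x - c * p x) = \<bar>c\<bar> * L2_norm M (\<lambda>x. f x - p x)"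
    using L2_norm_scale[of M c "\<lambda>x. f x - p x"] by (simp add: algebra_simps)
  also have "\<dots> \<le> (\<bar>c\<bar> + 1) * L2_norm M (\<lambda>x. f x - p x)"
    by (intro mult_right_mono L2_norm_nonneg) auto
  also have "\<dots> < e"
    using p(2) by (simp add: field_simps)
  finally show ?thesis using scale[OF p(1)] by (intro exI[of _ "\<lambda>x. c * p x"]) auto
qed

text \<open>Stone--Weierstrass gives uniform approximation of continuous functions on the compact carrier;
  indicators of closed sets are decreasing limits of continuous functions of the distance;
  Dynkin's lemma passes to Borel sets and monotone convergence to all of \<open>L\<^sup>2\<close>.\<close>

lemma polynomials_dense_L2:
  fixes \<nu> :: "'b::euclidean_space measure" and f :: "'b \<Rightarrow> real"
  assumes fin: "finite_measure \<nu>" and sets[measurable_cong]: "sets \<nu> = sets borel"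
    and K: "compact K" "AE x in \<nu>. x \<in> K"
    and f: "f \<in> L2 \<nu>" and e: "0 < e"
  shows "\<exists>p. real_polynomial_function p \<and> L2_norm \<nu> (\<lambda>x. f x - p x) < e"
proof -
  interpret finite_measure \<nu> by fact
  have space: "space \<nu> = UNIV" using sets_eq_imp_space_eq[OF sets] by simp
  have meas: "g \<in> borel_measurable \<nu>" if "continuous_on UNIV g" for g :: "'b \<Rightarrow> real"
    using borel_measurable_continuous_onI[OF that] by simp
  have cont: "g \<in> L2 \<nu>" if g: "continuous_on UNIV g" for g :: "'b \<Rightarrow> real"
  proof -
    have "compact (g ` K)" using K(1) g by (meson compact_continuous_image continuous_on_subset subset_UNIV)
    then obtain B where B: "\<forall>y\<in>g ` K. norm y \<le> B" using compact_imp_bounded bounded_iff by blast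
    show ?thesis
      by (rule L2_bounded[OF fin meas[OF g], of B]) (use K(2) B in \<open>auto elim!: eventually_mono\<close>)
  qed
  have poly_cont: "continuous_on UNIV p" if "real_polynomial_function p" for p :: "'b \<Rightarrow> real"
    using that by (simp add: continuous_on_polymonial_function real_polynomial_function_eq)
  define P where "P = (real_polynomial_function :: ('b \<Rightarrow> real) \<Rightarrow> bool)"
  have P: "p \<in> L2 \<nu>" if "P p" for p
    using that cont[OF poly_cont] by (simp add: P_def)
  define D where "D g \<longleftrightarrow> (\<forall>e>0. \<exists>p. P p \<and> L2_norm \<nu> (\<lambda>x. g x - p x) < e)" for g
  have D_cont: "D g" if g: "continuous_on UNIV g" for g
    unfolding D_def
  proof (intro allI impI)
    fix e :: real assume "0 < e"
    define s where "s = sqrt (measure \<nu> (space \<nu>))"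
    have "0 \<le> s" by (simp add: s_def)
    have d: "0 < e / (s + 1)" using \<open>0 < e\<close> \<open>0 \<le> s\<close> by simp
    obtain p where p: "real_polynomial_function p" "\<And>x. x \<in> K \<Longrightarrow> \<bar>g x - p x\<bar> < e / (s + 1)"
      using Stone_Weierstrass_real_polynomial_function[OF K(1) continuous_on_subset[OF g subset_UNIV] d] by blast
    have "L2_norm \<nu> (\<lambda>x. g x - p x) \<le> e / (s + 1) * s"
      unfolding s_def
    proof (rule L2_norm_bounded[OF fin])
      show "(\<lambda>x. g x - p x) \<in> borel_measurable \<nu>"
        using meas[OF g] meas[OF poly_cont[OF p(1)]] by simp
      show "AE x in \<nu>. norm (g x - p x) \<le> e / (sqrt (measure \<nu> (space \<nu>)) + 1)"
        using K(2) p(2) by (auto elim!: eventually_mono simp: s_def intro: less_imp_le)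
    qed (use d in \<open>simp add: s_def\<close>)
    also have "\<dots> < e" using \<open>0 < e\<close> \<open>0 \<le> s\<close> by (simp add: field_simps)
    finally show "\<exists>p. P p \<and> L2_norm \<nu> (\<lambda>x. g x - p x) < e" using p(1) by (auto simp: P_def)
  qed
  have D_lim: "D g" if "\<And>n. u n \<in> L2 \<nu>" "g \<in> L2 \<nu>" "(\<lambda>n. L2_norm \<nu> (\<lambda>x. g x - u n x)) \<longlonglongrightarrow> 0" "\<And>n. D (u n)"
    for g and u :: "nat \<Rightarrow> 'b \<Rightarrow> real"
    using L2_approx_limit[of u \<nu> g P] that P unfolding D_def by blast
  have D_add: "D (\<lambda>x. g x + h x)" if "g \<in> L2 \<nu>" "h \<in> L2 \<nu>" "D g" "D h" for g h
    unfolding D_def using that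
    by (intro allI impI L2_approx_add) (auto simp: P P_def D_def intro: real_polynomial_function.intros)
  have D_scale: "D (\<lambda>x. c * g x)" if "D g" for g c
    unfolding D_def using that
    by (intro allI impI L2_approx_scale) (auto simp: P P_def D_def intro: real_polynomial_function.intros)
  have ind_L2: "(indicator A :: 'b \<Rightarrow> real) \<in> L2 \<nu>" if "A \<in> sets \<nu>" for A
    using that by (intro L2_bounded[OF fin, of _ 1]) (auto simp: indicator_def)
  have D_closed: "D (indicator C)" if C: "closed C" for C
  proof (cases "C = {}")
    case True
    have "indicator C = (\<lambda>x::'b. 0::real)" using True by (auto simp: fun_eq_iff)
    then show ?thesis using D_cont[of "\<lambda>_. 0"] by simp
  next
    case False
    define u where "u n x = max 0 (1 - real n * infdist x C)" for n :: nat and x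
    have uc: "continuous_on UNIV (u n)" for n
      unfolding u_def by (intro continuous_intros)
    have lim: "(\<lambda>n. u n x) \<longlonglongrightarrow> indicator C x" for x
    proof (cases "x \<in> C")
      case True
      then show ?thesis by (simp add: u_def)
    next
      case out: False
      then have pos: "0 < infdist x C"
        using C False infdist_pos_not_in_closed by blast
      have "\<forall>\<^sub>F n in sequentially. u n x = 0"
        using eventually_ge_at_top[of "nat \<lceil>1 / infdist x C\<rceil>"]
      proof eventually_elim
        case (elim n)
        then have "1 / infdist x C \<le> real n" by linarith
        then show ?case using pos by (simp add: u_def field_simps)
      qed
      then show ?thesis using out by (simp add: tendsto_eventually)
    qed
    have bound: "norm (u n x) \<le> 1" for n x
      using infdist_nonneg[of x C] by (simp add: u_def)
    note conv = L2_dominated_convergence[of "\<lambda>_. 1" \<nu> "indicator C" u,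
        OF L2_const[OF fin] _ meas[OF uc] bound lim]
    have C': "(indicator C :: 'b \<Rightarrow> real) \<in> borel_measurable \<nu>"
      using C by (intro borel_measurable_indicator) (simp add: sets borel_closed)
    show ?thesis
      by (rule D_lim[of u]) (use conv[OF C'] D_cont[OF uc] in auto)
  qed
  have D_ind: "D (indicator A)" if A: "A \<in> sets \<nu>" for A
  proof -
    have bs: "sets \<nu> = sigma_sets UNIV (Collect closed)"
      by (subst sets, subst borel_eq_closed) (simp add: sets_measure_of)
    show ?thesis
    proof (rule sigma_sets_induct_disjoint[of "Collect closed" UNIV])
      show "Int_stable (Collect closed :: 'b set set)" by (auto simp: Int_stable_def)
      show "A \<in> sigma_sets UNIV (Collect closed)" using A bs by simp
      show "D (indicator A)" if "A \<in> Collect closed" for A using D_closed that by simp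
      show "D (indicator {})" using D_closed[of "{}"] by simp
      show "D (indicator (UNIV - A))" if "A \<in> sigma_sets UNIV (Collect closed)" "D (indicator A)" for A
      proof -
        have "D (\<lambda>x. 1 + (-1) * indicator A x)"
          using that bs by (intro D_add[OF _ _ D_cont D_scale] L2_const L2_cmult ind_L2 fin) auto
        also have "(\<lambda>x. 1 + (-1) * indicator A x) = (indicator (UNIV - A) :: _ \<Rightarrow> real)"
          by (auto simp: fun_eq_iff indicator_def)
        finally show ?thesis .
      qed
      show "D (indicator (\<Union>i. A i))" if A: "disjoint_family A" "range A \<subseteq> sigma_sets UNIV (Collect closed)"
        "\<And>i. D (indicator (A i))" for A :: "nat \<Rightarrow> 'b set"
      proof -
        define u where "u n x = (\<Sum>i<n. indicator (A i) x :: real)" for n x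
        have u_eq: "u n x = indicator (\<Union>i<n. A i) x" for n x
          unfolding u_def using A(1)
          by (subst indicator_UN_disjoint) (auto simp: disjoint_family_on_def)
        have Am: "A i \<in> sets \<nu>" for i using A(2) bs by auto
        have uL: "u n \<in> L2 \<nu>" for n
          unfolding u_def by (intro L2_sum ind_L2 Am)
        have Du: "D (u n)" for n
        proof (induction n)
          case 0
          then show ?case using D_cont[of "\<lambda>_. 0"] by (simp add: u_def)
        next
          case (Suc n)
          have "D (\<lambda>x. u n x + indicator (A n) x)"
            by (intro D_add Suc uL ind_L2 Am A(3))
          then show ?case by (simp add: u_def)
        qed
        have lim: "(\<lambda>n. u n x) \<longlonglongrightarrow> indicator (\<Union>i. A i) x" for x
        proof (rule tendsto_eventually, cases "x \<in> (\<Union>i. A i)")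
          case True
          then obtain i where i: "x \<in> A i" by auto
          show "\<forall>\<^sub>F n in sequentially. u n x = indicator (\<Union>i. A i) x"
            using eventually_gt_at_top[of i] by eventually_elim (use i in \<open>auto simp: u_eq indicator_def\<close>)
        qed (auto simp: u_eq indicator_def)
        have bound: "norm (u n x) \<le> 1" for n x by (simp add: u_eq indicator_def)
        have Um: "(indicator (\<Union>i. A i) :: 'b \<Rightarrow> real) \<in> borel_measurable \<nu>" using Am by simp
        show ?thesis
          by (rule D_lim[of u])
             (use L2_dominated_convergence[OF L2_const[OF fin] Um L2_D(1)[OF uL] bound lim] Du in auto)
      qed
    qed auto
  qed
  have D_nonneg: "g \<in> L2 \<nu> \<longrightarrow> D g" if "g \<in> borel_measurable \<nu>" "\<And>x. 0 \<le> g x" for g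
    using that
  proof (induction rule: borel_measurable_induct_real)
    case (set A)
    then show ?case using D_ind by simp
  next
    case (mult u c)
    show ?case
    proof
      assume L: "(\<lambda>x. c * u x) \<in> L2 \<nu>"
      show "D (\<lambda>x. c * u x)"
      proof (cases "c = 0")
        case True
        then show ?thesis using D_cont[of "\<lambda>_. 0"] by simp
      next
        case False
        then have "u \<in> L2 \<nu>" using L2_cmult[OF L, of "1 / c"] by simp
        then show ?thesis using mult D_scale by blast
      qed
    qed
  next
    case (add u v)
    show ?case
    proof
      assume L: "(\<lambda>x. v x + u x) \<in> L2 \<nu>"
      have "u \<in> L2 \<nu>" "v \<in> L2 \<nu>"
        using add by (auto intro!: L2_dominated[OF L, of _ 1] AE_I2)
      then show "D (\<lambda>x. v x + u x)" using add D_add by blast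
    qed
  next
    case (seq U)
    show ?case
    proof
      assume L: "g \<in> L2 \<nu>"
      have lim: "(\<lambda>n. U n x) \<longlonglongrightarrow> g x" for x using seq by (simp add: space)
      have le: "norm (U n x) \<le> g x" for n x
        using incseq_le[of "\<lambda>n. U n x", OF _ lim] seq by (auto simp: incseq_def le_fun_def)
      note conv = L2_dominated_convergence[of g \<nu> g U, OF L L2_D(1)[OF L] seq(1) le lim]
      show "D g" by (rule D_lim[of U]) (use conv seq in auto)
    qed
  qed
  have "D (\<lambda>x. max 0 (f x) + (-1) * max 0 (- f x))"
    using f by (intro D_add D_scale L2_cmult D_nonneg[rule_format] L2_dominated[OF f, of _ 1])
       (auto intro!: AE_I2 dest: L2_D(1))
  also have "(\<lambda>x. max 0 (f x) + (-1) * max 0 (- f x)) = f" by (auto simp: max_def fun_eq_iff)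
  finally show ?thesis using e by (auto simp: D_def P_def)
qed

section \<open>Smooth functions\<close>

lemma partial_deriv_eq: "(f has_derivative D) (at x) \<Longrightarrow> partial_deriv b f x = D b"
  unfolding partial_deriv_def using frechet_derivative_at by metis

lemma C_k_SucI:
  assumes "\<And>x. (f has_derivative D x) (at x)" and "\<And>b. b \<in> Basis \<Longrightarrow> C_k k (\<lambda>x. D x b)"
  shows "C_k (Suc k) f"
proof -
  have "partial_deriv b f = (\<lambda>x. D x b)" for b
    using partial_deriv_eq[OF assms(1)] by auto
  then show ?thesis
    using assms by (auto simp: differentiable_on_def differentiable_def intro: has_derivative_at_withinI)
qed

lemma C_k_SucD:
  assumes "C_k (Suc k) f"
  shows "(f has_derivative frechet_derivative f (at x)) (at x)"
    and "b \<in> Basis \<Longrightarrow> C_k k (\<lambda>x. frechet_derivative f (at x) b)"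
  using assms frechet_derivative_works[of f "at x"]
  by (auto simp: differentiable_on_def partial_deriv_def[abs_def])

lemma C_k_Suc_imp: "C_k (Suc k) f \<Longrightarrow> C_k k f"
proof (induction k arbitrary: f)
  case 0
  then show ?case by (simp add: differentiable_imp_continuous_on)
next
  case (Suc k)
  then show ?case by (subst C_k.simps) auto
qed

lemma C_k_continuous: "C_k k f \<Longrightarrow> continuous_on UNIV f"
  by (induction k) (use C_k_Suc_imp in \<open>auto simp del: C_k.simps(2)\<close>)

lemma C_k_const: "C_k k (\<lambda>_. c)"
proof (induction k arbitrary: c)
  case (Suc k)
  show ?case by (rule C_k_SucI[of _ "\<lambda>_ _. 0"]) (auto intro: Suc)
qed simp

lemma C_k_add: "C_k k f \<Longrightarrow> C_k k g \<Longrightarrow> C_k k (\<lambda>x. f x + g x)"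
proof (induction k arbitrary: f g)
  case 0
  then show ?case by (simp add: continuous_on_add)
next
  case (Suc k)
  show ?case
    by (rule C_k_SucI[OF has_derivative_add[OF C_k_SucD(1)[OF Suc.prems(1)] C_k_SucD(1)[OF Suc.prems(2)]]])
       (intro Suc.IH C_k_SucD(2) Suc.prems)
qed

lemma C_k_mult:
  fixes f g :: "'a::euclidean_space \<Rightarrow> real"
  shows "C_k k f \<Longrightarrow> C_k k g \<Longrightarrow> C_k k (\<lambda>x. f x * g x)"
proof (induction k arbitrary: f g)
  case 0
  then show ?case by (simp add: continuous_on_mult)
next
  case (Suc k)
  show ?case
    by (rule C_k_SucI[OF has_derivative_mult[OF C_k_SucD(1)[OF Suc.prems(1)] C_k_SucD(1)[OF Suc.prems(2)]]])
       (intro C_k_add Suc.IH C_k_SucD(2) Suc.prems C_k_Suc_imp[OF Suc.prems(1)] C_k_Suc_imp[OF Suc.prems(2)])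
qed

lemma C_k_bounded_linear: "bounded_linear f \<Longrightarrow> C_k k f"
proof (cases k)
  case 0
  then show "bounded_linear f \<Longrightarrow> C_k k f"
    by (simp add: linear_continuous_on)
next
  case (Suc l)
  then show "bounded_linear f \<Longrightarrow> C_k k f"
    by (auto intro!: C_k_SucI[of f "\<lambda>_. f"] C_k_const simp del: C_k.simps simp: bounded_linear_imp_has_derivative)
qed

lemma C_k_real_SucI:
  fixes g :: "real \<Rightarrow> real"
  assumes "\<And>x. (g has_real_derivative g' x) (at x)" "C_k k g'"
  shows "C_k (Suc k) g"
  by (rule C_k_SucI[of g "\<lambda>x. (*) (g' x)"]) (use assms in \<open>auto simp: has_field_derivative_def\<close>)

lemma C_k_compose:
  fixes g :: "real \<Rightarrow> real" and f :: "'a::euclidean_space \<Rightarrow> real"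
  shows "C_k k g \<Longrightarrow> C_k k f \<Longrightarrow> C_k k (\<lambda>x. g (f x))"
proof (induction k arbitrary: f g)
  case 0
  then show ?case using continuous_on_compose2[of UNIV g UNIV f] by simp
next
  case (Suc k)
  let ?g' = "\<lambda>y. frechet_derivative g (at y) 1" and ?f' = "\<lambda>x. frechet_derivative f (at x)"
  have "((\<lambda>x. g (f x)) has_derivative (\<lambda>h. ?g' (f x) * ?f' x h)) (at x)" for x
  proof -
    have g: "(g has_derivative frechet_derivative g (at (f x))) (at (f x))"
      by (rule C_k_SucD(1)[OF Suc.prems(1)])
    interpret linear "frechet_derivative g (at (f x))"
      using g by (rule has_derivative_linear)
    have eq: "frechet_derivative g (at (f x)) = (\<lambda>h. ?g' (f x) * h)"
    proof
      fix h show "frechet_derivative g (at (f x)) h = ?g' (f x) * h"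
        using scaleR[of h 1] by simp
    qed
    have "(g has_derivative (\<lambda>h. ?g' (f x) * h)) (at (f x))"
      using g by (subst (asm) eq)
    then show ?thesis
      by (rule has_derivative_compose[OF C_k_SucD(1)[OF Suc.prems(2)]])
  qed
  moreover have "C_k k (\<lambda>x. ?g' (f x) * ?f' x b)" if "b \<in> Basis" for b
    by (rule C_k_mult[OF Suc.IH[OF C_k_SucD(2)[OF Suc.prems(1)] C_k_Suc_imp[OF Suc.prems(2)]]
          C_k_SucD(2)[OF Suc.prems(2) that]]) simp
  ultimately show ?case by (rule C_k_SucI)
qed

lemma smooth_continuous: "smooth f \<Longrightarrow> continuous_on UNIV f"
  by (auto simp: smooth_def dest: C_k_continuous)

lemma smooth_const: "smooth (\<lambda>_. c)"
  by (simp add: smooth_def C_k_const)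

lemma smooth_add: "smooth f \<Longrightarrow> smooth g \<Longrightarrow> smooth (\<lambda>x. f x + g x)"
  by (simp add: smooth_def C_k_add)

lemma smooth_mult: "smooth f \<Longrightarrow> smooth g \<Longrightarrow> smooth (\<lambda>x. f x * g x)"
  by (simp add: smooth_def C_k_mult)

lemma smooth_diff: "smooth f \<Longrightarrow> smooth g \<Longrightarrow> smooth (\<lambda>x. f x - g x)"
  using smooth_add[of f "\<lambda>x. (-1) * g x"] smooth_mult[OF smooth_const[of "-1"], of g] by simp

lemma smooth_sum: "(\<And>i. i \<in> F \<Longrightarrow> smooth (f i)) \<Longrightarrow> smooth (\<lambda>x. \<Sum>i\<in>F. f i x)"
  by (induction F rule: infinite_finite_induct) (auto intro: smooth_const smooth_add)

lemma smooth_bounded_linear: "bounded_linear f \<Longrightarrow> smooth f"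
  by (simp add: smooth_def C_k_bounded_linear)

lemma smooth_compose:
  fixes g :: "real \<Rightarrow> real"
  shows "smooth g \<Longrightarrow> smooth f \<Longrightarrow> smooth (\<lambda>x. g (f x))"
  by (simp add: smooth_def C_k_compose)

lemma smooth_has_derivative:
  assumes "smooth f"
  shows "(f has_derivative frechet_derivative f (at x)) (at x)"
  using C_k_SucD(1)[of 0] assms unfolding smooth_def by blast

lemma smooth_partial_deriv: "smooth f \<Longrightarrow> b \<in> Basis \<Longrightarrow> smooth (partial_deriv b f)"
  unfolding smooth_def by (metis C_k.simps(2))

lemma smooth_sin: "smooth (sin :: real \<Rightarrow> real)" and smooth_cos: "smooth (cos :: real \<Rightarrow> real)"
proof -
  have "C_k k (\<lambda>x::real. a * sin x + b * cos x)" for k a b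
  proof (induction k arbitrary: a b)
    case 0
    then show ?case by (auto intro!: continuous_intros)
  next
    case (Suc k)
    show ?case
      by (rule C_k_real_SucI[of _ "\<lambda>x. (-b) * sin x + a * cos x"])
         (rule derivative_eq_intros refl Suc | simp)+
  qed
  from this[of _ 1 0] this[of _ 0 1] show "smooth (sin :: real \<Rightarrow> real)" "smooth (cos :: real \<Rightarrow> real)"
    by (simp_all add: smooth_def)
qed

text \<open>The function \<open>t \<mapsto> exp (- 1 / t)\<close>, extended by zero, is flat at \<open>0\<close>; the powers of \<open>1 / t\<close> are
  included because they appear in its derivatives.\<close>

definition flat :: "nat \<Rightarrow> real \<Rightarrow> real" where
  "flat m t = (if t > 0 then exp (- 1 / t) * (1 / t) ^ m else 0)"

text \<open>A single term of the exponential series for \<open>exp (1 / t)\<close> already dominates, and the two spare powers of \<open>t\<close>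
  make the derivative at \<open>0\<close> vanish.\<close>

lemma flat_bound: "\<bar>flat m t\<bar> \<le> fact (m + 2) * t\<^sup>2"
proof (cases "t > 0")
  case True
  have "(1 / t) ^ (m + 2) / fact (m + 2) \<le> exp (1 / t)"
  proof -
    have "(1 / t) ^ (m + 2) / fact (m + 2) = (\<Sum>k\<in>{m+2}. (1 / t) ^ k /\<^sub>R fact k)"
      by (simp add: divide_inverse mult.commute)
    also have "\<dots> \<le> exp (1 / t)"
      unfolding exp_def using True
      by (intro sum_le_suminf summable_exp_generic) auto
    finally show ?thesis .
  qed
  then have "(1 / t) ^ (m + 2) \<le> fact (m + 2) * exp (1 / t)"
    by (simp add: pos_divide_le_eq mult.commute del: fact_Suc power_Suc add_2_eq_Suc')
  then have "(1 / t) ^ (m + 2) * (exp (- 1 / t) * t\<^sup>2) \<le> fact (m + 2) * exp (1 / t) * (exp (- 1 / t) * t\<^sup>2)"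
    by (intro mult_right_mono) auto
  also have "fact (m + 2) * exp (1 / t) * (exp (- 1 / t) * t\<^sup>2) = fact (m + 2) * t\<^sup>2"
    by (simp add: exp_minus field_simps del: fact_Suc)
  also have "(1 / t) ^ (m + 2) * (exp (- 1 / t) * t\<^sup>2) = flat m t"
    using True by (simp add: flat_def power_add power_divide power2_eq_square)
  finally show ?thesis using True by (simp add: flat_def)
qed (simp add: flat_def)

lemma flat_deriv: "(flat m has_real_derivative flat (m + 2) t - m * flat (m + 1) t) (at t)"
proof -
  consider "t > 0" | "t < 0" | "t = 0" by linarith
  then show ?thesis
  proof cases
    case 1
    have "((\<lambda>t. exp (- 1 / t) * (1 / t) ^ m) has_real_derivative
        flat (m + 2) t - m * flat (m + 1) t) (at t)"
      using 1 by (auto intro!: derivative_eq_intros simp: flat_def power2_eq_square field_simps)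
        (cases m; simp add: field_simps)
    then show ?thesis
      by (rule has_field_derivative_transform_within_open[of _ _ _ "{0<..}"])
         (use 1 in \<open>auto simp: flat_def\<close>)
  next
    case 2
    have "((\<lambda>t. 0) has_real_derivative 0) (at t)" by simp
    then have "(flat m has_real_derivative 0) (at t)"
      by (rule has_field_derivative_transform_within_open[of _ _ _ "{..<0}"])
         (use 2 in \<open>auto simp: flat_def\<close>)
    then show ?thesis using 2 by (simp add: flat_def)
  next
    case 3
    have "((\<lambda>h. (flat m (0 + h) - flat m 0) / h) \<longlongrightarrow> 0) (at 0)"
    proof (rule Lim_null_comparison)
      show "\<forall>\<^sub>F h in at 0. norm ((flat m (0 + h) - flat m 0) / h) \<le> fact (m + 2) * \<bar>h\<bar>"
      proof (rule eventually_mono[OF eventually_neq_at_within])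
        fix h :: real assume "h \<noteq> 0"
        then show "norm ((flat m (0 + h) - flat m 0) / h) \<le> fact (m + 2) * \<bar>h\<bar>"
          using flat_bound[of m h]
          by (simp add: flat_def[of m 0] field_simps power2_eq_square abs_mult_self_eq del: fact_Suc)
      qed
      show "((\<lambda>h. fact (m + 2) * \<bar>h\<bar>) \<longlongrightarrow> (0::real)) (at 0)"
        by (auto intro!: tendsto_eq_intros)
    qed
    then have "(flat m has_real_derivative 0) (at 0)"
      by (simp add: DERIV_def)
    then show ?thesis using 3 by (simp add: flat_def)
  qed
qed

lemma smooth_flat: "smooth (flat m)"
proof -
  have "C_k k (flat m)" for k
  proof (induction k arbitrary: m)
    case 0
    have "isCont (flat m) t" for t
      using flat_deriv DERIV_isCont by blast
    then show ?case by (simp add: continuous_at_imp_continuous_on)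
  next
    case (Suc k)
    have "C_k k (\<lambda>t. flat (m + 2) t + (- real m) * flat (m + 1) t)"
      by (intro C_k_add C_k_mult C_k_const Suc)
    then show ?case
      by (intro C_k_real_SucI[of "flat m" "\<lambda>t. flat (m + 2) t - m * flat (m + 1) t"] flat_deriv) simp
  qed
  then show ?thesis by (simp add: smooth_def)
qed

section \<open>Integration over the slab\<close>

definition unit_line :: "real measure" where
  "unit_line = restrict_space lborel {0<..<1}"

definition period :: "real \<Rightarrow> real measure" where
  "period L = restrict_space lborel {0..<L}"

definition torus :: "real \<Rightarrow> (real \<times> real) measure" where
  "torus L = period L \<Otimes>\<^sub>M period L"

lemma pair_measure_restrict_space:
  assumes M: "sigma_finite_measure M" and N: "sigma_finite_measure N"
    and A: "A \<in> sets M" and B: "B \<in> sets N"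
  shows "restrict_space M A \<Otimes>\<^sub>M restrict_space N B = restrict_space (M \<Otimes>\<^sub>M N) (A \<times> B)"
proof (rule pair_measure_eqI)
  interpret N: sigma_finite_measure N by fact
  note [measurable] = A B
  show "sigma_finite_measure (restrict_space M A)" "sigma_finite_measure (restrict_space N B)"
    using assms by (auto intro: sigma_finite_measure_restrict_space)
  have AB: "A \<times> B \<inter> space (M \<Otimes>\<^sub>M N) \<in> sets (M \<Otimes>\<^sub>M N)" by simp
  have sub: "A \<subseteq> space M" "B \<subseteq> space N" using sets.sets_into_space[OF A] sets.sets_into_space[OF B] .
  have rM: "sets (restrict_space M A) = {C \<in> sets M. C \<subseteq> A}" and
    rN: "sets (restrict_space N B) = {C \<in> sets N. C \<subseteq> B}" and
    rMN: "sets (restrict_space (M \<Otimes>\<^sub>M N) (A \<times> B)) = {C \<in> sets (M \<Otimes>\<^sub>M N). C \<subseteq> A \<times> B}"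
    using A B AB by (auto simp: sets_restrict_space_iff)
  show "sets (restrict_space M A \<Otimes>\<^sub>M restrict_space N B) = sets (restrict_space (M \<Otimes>\<^sub>M N) (A \<times> B))"
  proof
    show "sets (restrict_space M A \<Otimes>\<^sub>M restrict_space N B) \<subseteq> sets (restrict_space (M \<Otimes>\<^sub>M N) (A \<times> B))"
      by (rule sets_pair_in_sets) (auto simp: rM rN rMN)
    show "sets (restrict_space (M \<Otimes>\<^sub>M N) (A \<times> B)) \<subseteq> sets (restrict_space M A \<Otimes>\<^sub>M restrict_space N B)"
    proof
      fix C assume C: "C \<in> sets (restrict_space (M \<Otimes>\<^sub>M N) (A \<times> B))"
      have "(\<lambda>x. x) \<in> restrict_space M A \<rightarrow>\<^sub>M M" "(\<lambda>x. x) \<in> restrict_space N B \<rightarrow>\<^sub>M N"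
        by (simp_all add: measurable_restrict_space1)
      then have "(\<lambda>p. (fst p, snd p)) \<in> restrict_space M A \<Otimes>\<^sub>M restrict_space N B \<rightarrow>\<^sub>M M \<Otimes>\<^sub>M N"
        by measurable
      then have "(\<lambda>p. (fst p, snd p)) -` C \<inter> space (restrict_space M A \<Otimes>\<^sub>M restrict_space N B)
          \<in> sets (restrict_space M A \<Otimes>\<^sub>M restrict_space N B)"
        using C rMN by (intro measurable_sets) auto
      also have "(\<lambda>p. (fst p, snd p)) -` C \<inter> space (restrict_space M A \<Otimes>\<^sub>M restrict_space N B) = C"
        using C sub by (auto simp: rMN space_pair_measure space_restrict_space)
      finally show "C \<in> sets (restrict_space M A \<Otimes>\<^sub>M restrict_space N B)" .
    qed
  qed
  fix C D assume C: "C \<in> sets (restrict_space M A)" and D: "D \<in> sets (restrict_space N B)"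
  then have "emeasure (restrict_space (M \<Otimes>\<^sub>M N) (A \<times> B)) (C \<times> D) = emeasure (M \<Otimes>\<^sub>M N) (C \<times> D)"
    by (intro emeasure_restrict_space AB) (auto simp: rM rN)
  also have "\<dots> = emeasure M C * emeasure N D"
    using C D by (intro N.emeasure_pair_measure_Times) (auto simp: rM rN)
  also have "\<dots> = emeasure (restrict_space M A) C * emeasure (restrict_space N B) D"
    using C D A B by (simp add: rM rN emeasure_restrict_space)
  finally show "emeasure (restrict_space M A) C * emeasure (restrict_space N B) D
      = emeasure (restrict_space (M \<Otimes>\<^sub>M N) (A \<times> B)) (C \<times> D)" by simp
qed

lemma torus_eq: "torus L = restrict_space lborel ({0..<L} \<times> {0..<L})"
  unfolding torus_def period_def lborel_prod[symmetric]
  by (rule pair_measure_restrict_space) (auto intro: sigma_finite_lborel)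

lemma slab_eq: "slab L = unit_line \<Otimes>\<^sub>M torus L"
  unfolding slab_def torus_eq unit_line_def
  by (subst lborel_prod[symmetric], rule pair_measure_restrict_space[symmetric])
     (auto intro: sigma_finite_lborel borel_Times)

lemma slab_boundary_eq: "slab_boundary L = count_space {0, 1} \<Otimes>\<^sub>M torus L"
  by (simp add: slab_boundary_def torus_eq)

lemma space_slab: "space (slab L) = {0<..<1} \<times> {0..<L} \<times> {0..<L}"
  by (simp add: slab_def space_restrict_space)

lemma finite_unit_line: "finite_measure unit_line" and finite_period: "finite_measure (period L)"
  by (cases "0 \<le> L"; auto intro!: finite_measureI
      simp: unit_line_def period_def space_restrict_space emeasure_restrict_space)+

lemma finite_torus: "finite_measure (torus L)" and finite_slab: "finite_measure (slab L)"
  unfolding slab_eq torus_def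
  by (intro finite_measure_pair_measure finite_unit_line finite_period)+

lemma measure_unit_line: "measure unit_line (space unit_line) = 1"
  by (simp add: unit_line_def space_restrict_space measure_restrict_space)

lemma pair_sigma_finite_slab: "pair_sigma_finite unit_line (torus L)"
  using finite_unit_line finite_torus
  by (intro pair_sigma_finite.intro finite_measure.axioms)

lemma pair_sigma_finite_boundary: "pair_sigma_finite (count_space {0, 1::real}) (torus L)"
  using finite_torus
  by (intro pair_sigma_finite.intro finite_measure.axioms sigma_finite_measure_count_space_finite) auto

lemma continuous_L2_restrict:
  fixes f :: "'a::euclidean_space \<Rightarrow> 'b::euclidean_space"
  assumes f: "continuous_on UNIV f" and S: "S \<in> sets borel" "bounded S"
    and fin: "finite_measure (restrict_space lborel S)"
  shows "f \<in> L2 (restrict_space lborel S)"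
proof -
  have "compact (f ` closure S)"
    using f S(2) by (intro compact_continuous_image) (auto intro: continuous_on_subset)
  then obtain B where B: "\<forall>y\<in>f ` closure S. norm y \<le> B" using compact_imp_bounded bounded_iff by blast
  have "f \<in> borel_measurable (restrict_space lborel S)"
    using borel_measurable_continuous_onI[OF f] by (intro measurable_restrict_space1) simp
  then show ?thesis
    by (rule L2_bounded[OF fin, of _ B]) (use B closure_subset[of S] in \<open>auto simp: space_restrict_space intro!: AE_I2\<close>)
qed

lemma continuous_L2_unit_line: "continuous_on UNIV f \<Longrightarrow> f \<in> L2 unit_line"
  using continuous_L2_restrict[of f "{0<..<1}"] finite_unit_line by (simp add: unit_line_def)

lemma continuous_L2_period: "continuous_on UNIV f \<Longrightarrow> f \<in> L2 (period L)"
  using continuous_L2_restrict[of f "{0..<L}"] finite_period[of L] by (simp add: period_def)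

lemma continuous_L2_torus: "continuous_on UNIV f \<Longrightarrow> f \<in> L2 (torus L)"
  using continuous_L2_restrict[of f "{0..<L} \<times> {0..<L}"] finite_torus[of L]
  by (simp add: torus_eq bounded_Times borel_Times)

lemma continuous_L2_slab: "continuous_on UNIV f \<Longrightarrow> f \<in> L2 (slab L)"
  using continuous_L2_restrict[of f "{0<..<1} \<times> {0..<L} \<times> {0..<L}"] finite_slab[of L]
  by (simp add: slab_def bounded_Times borel_Times)

lemma continuous_slice:
  fixes f :: "'a::topological_space \<times> 'b::topological_space \<Rightarrow> 'c::topological_space"
  assumes "continuous_on UNIV f"
  shows "continuous_on UNIV (\<lambda>w. f (x, w))" "continuous_on UNIV (\<lambda>x. f (x, w))"
  by (rule continuous_on_compose2[OF assms]; auto intro!: continuous_intros)+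

lemma integral_boundary:
  fixes f :: "point \<Rightarrow> real"
  assumes "\<And>x. x \<in> {0, 1} \<Longrightarrow> integrable (torus L) (\<lambda>w. f (x, w))"
  shows "integrable (slab_boundary L) f"
    and "(\<integral>p. f p \<partial>slab_boundary L) = (\<integral>w. f (0, w) \<partial>torus L) + (\<integral>w. f (1, w) \<partial>torus L)"
proof -
  interpret pair_sigma_finite "count_space {0, 1::real}" "torus L"
    by (rule pair_sigma_finite_boundary)
  show int: "integrable (slab_boundary L) f"
    unfolding slab_boundary_eq using assms
    by (intro Fubini_integrable measurable_pair_measure_countable1)
       (auto simp: AE_count_space integrable_count_space)
  show "(\<integral>p. f p \<partial>slab_boundary L) = (\<integral>w. f (0, w) \<partial>torus L) + (\<integral>w. f (1, w) \<partial>torus L)"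
    using integral_fst'[of f] int
    by (simp add: slab_boundary_eq lebesgue_integral_count_space_finite)
qed

lemma L2_boundary:
  fixes f :: "point \<Rightarrow> real"
  assumes f: "\<And>x. x \<in> {0, 1} \<Longrightarrow> (\<lambda>w. f (x, w)) \<in> L2 (torus L)"
  shows "f \<in> L2 (slab_boundary L)"
    and "(L2_norm (slab_boundary L) f)\<^sup>2
      = (L2_norm (torus L) (\<lambda>w. f (0, w)))\<^sup>2 + (L2_norm (torus L) (\<lambda>w. f (1, w)))\<^sup>2"
proof -
  have i: "integrable (torus L) (\<lambda>w. (norm (f (x, w)))\<^sup>2)" if "x \<in> {0, 1}" for x
    using L2_D(2)[OF f[OF that]] .
  have "f \<in> borel_measurable (slab_boundary L)"
    unfolding slab_boundary_eq using f
    by (intro measurable_pair_measure_countable1) (auto dest: L2_D)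
  then show "f \<in> L2 (slab_boundary L)"
    using integral_boundary(1)[of L "\<lambda>p. (norm (f p))\<^sup>2", OF i] by (simp add: L2_def)
  show "(L2_norm (slab_boundary L) f)\<^sup>2
      = (L2_norm (torus L) (\<lambda>w. f (0, w)))\<^sup>2 + (L2_norm (torus L) (\<lambda>w. f (1, w)))\<^sup>2"
    unfolding L2_norm_sq by (rule integral_boundary(2)[of L "\<lambda>p. (norm (f p))\<^sup>2", OF i])
qed

lemma continuous_L2_boundary:
  fixes f :: "point \<Rightarrow> real"
  shows "continuous_on UNIV f \<Longrightarrow> f \<in> L2 (slab_boundary L)"
  by (intro L2_boundary continuous_L2_torus continuous_slice)

lemma integral_restrict_interval_FTC:
  fixes F f :: "real \<Rightarrow> real"
  assumes "a \<le> b" and I: "{a<..<b} \<subseteq> I" "I \<subseteq> {a..b}" "I \<in> sets borel"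
    and F: "\<And>x. (F has_real_derivative f x) (at x)" and f: "continuous_on UNIV f"
  shows "(\<integral>x. f x \<partial>restrict_space lborel I) = F b - F a"
proof -
  have [measurable]: "f \<in> borel_measurable borel" using f by (rule borel_measurable_continuous_onI)
  note [measurable] = I(3)
  have "(\<integral>x. f x \<partial>restrict_space lborel I) = (\<integral>x. indicator I x *\<^sub>R f x \<partial>lborel)"
    using I(3) by (simp add: integral_restrict_space)
  also have "\<dots> = (\<integral>x. indicator {a..b} x *\<^sub>R f x \<partial>lborel)"
  proof (rule integral_cong_AE)
    show "AE x in lborel. indicator I x *\<^sub>R f x = indicator {a..b} x *\<^sub>R f x"
      using AE_lborel_singleton[of a] AE_lborel_singleton[of b]
    proof eventually_elim
      case (elim x)
      then have "x \<in> I \<longleftrightarrow> x \<in> {a..b}" using I by force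
      then show ?case by (simp add: indicator_def)
    qed
  qed simp_all
  also have "\<dots> = F b - F a"
    using F f assms(1)
    by (intro integral_FTC_Icc) (auto intro: has_field_derivative_at_within continuous_on_subset
        simp: has_real_derivative_iff_has_vector_derivative[symmetric])
  finally show ?thesis .
qed

lemma integral_unit_line_FTC:
  fixes F f :: "real \<Rightarrow> real"
  assumes "\<And>x. (F has_real_derivative f x) (at x)" and "continuous_on UNIV f"
  shows "(\<integral>x. f x \<partial>unit_line) = F 1 - F 0"
  unfolding unit_line_def by (rule integral_restrict_interval_FTC) (use assms in auto)

lemma integral_period_FTC:
  fixes F f :: "real \<Rightarrow> real"
  assumes "0 \<le> L" "\<And>x. (F has_real_derivative f x) (at x)" and "continuous_on UNIV f"
  shows "(\<integral>x. f x \<partial>period L) = F L - F 0"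
  unfolding period_def by (rule integral_restrict_interval_FTC) (use assms in auto)

lemma smooth_slice_derivative:
  fixes u :: "point \<Rightarrow> real"
  assumes "smooth u"
  shows "((\<lambda>x. u (x, w)) has_real_derivative partial_deriv (1, 0) u (x, w)) (at x)"
proof -
  let ?D = "frechet_derivative u (at (x, w))"
  have u: "(u has_derivative ?D) (at (x, w))" by (rule smooth_has_derivative[OF assms])
  then interpret linear ?D by (rule has_derivative_linear)
  have "((\<lambda>x. (x, w)) has_derivative (\<lambda>h. (h, 0))) (at x)"
    by (auto intro!: derivative_eq_intros)
  from has_derivative_compose[OF this u]
  have "((\<lambda>x. u (x, w)) has_derivative (\<lambda>h. ?D (h, 0))) (at x)" .
  moreover have "?D (h, 0) = partial_deriv (1, 0) u (x, w) * h" for h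
    using scaleR[of h "(1, 0)"] by (simp add: partial_deriv_def)
  ultimately show ?thesis by (simp add: has_field_derivative_def)
qed

lemma e1_Basis: "(1, 0) \<in> (Basis :: point set)"
  by (simp add: Basis_prod_def)

lemma integral_slice_FTC:
  fixes u :: "point \<Rightarrow> real"
  assumes "smooth u"
  shows "(\<integral>x. partial_deriv (1, 0) u (x, w) \<partial>unit_line) = u (1, w) - u (0, w)"
  using smooth_slice_derivative[OF assms]
  by (rule integral_unit_line_FTC)
     (intro continuous_slice smooth_continuous smooth_partial_deriv assms e1_Basis)

lemma integral_slab_iterated:
  fixes f :: "point \<Rightarrow> real"
  assumes "integrable (slab L) f"
  shows "(\<integral>p. f p \<partial>slab L) = (\<integral>w. (\<integral>x. f (x, w) \<partial>unit_line) \<partial>torus L)"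
proof -
  interpret pair_sigma_finite unit_line "torus L" by (rule pair_sigma_finite_slab)
  show ?thesis using integral_snd[of "\<lambda>x w. f (x, w)"] assms by (simp add: slab_eq)
qed

lemma continuous_integrable_slab:
  fixes f :: "point \<Rightarrow> real"
  shows "continuous_on UNIV f \<Longrightarrow> integrable (slab L) f"
  by (rule L2_integrable[OF finite_slab continuous_L2_slab])

text \<open>The weight \<open>x - 1 / 2\<close> has derivative \<open>1\<close>, takes the values \<open>\<plusminus>1 / 2\<close> on the boundary and is at
  most \<open>1 / 2\<close> in modulus, so \<open>\<integral> u\<^sup>2 + 2 (x - 1 / 2) u u\<^sub>x = (1 / 2) \<integral>\<^sub>\<partial> u\<^sup>2\<close> and the cross term is
  at most \<open>\<bar>u u\<^sub>x\<bar> \<le> (u\<^sup>2 + u\<^sub>x\<^sup>2) / 2\<close>; half of \<open>u\<^sup>2\<close> is absorbed on the left.\<close>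

lemma poincare_smooth:
  fixes u :: "point \<Rightarrow> real"
  assumes u: "smooth u"
  shows "(L2_norm (slab L) u)\<^sup>2
    \<le> (L2_norm (slab L) (partial_deriv (1, 0) u))\<^sup>2 + (L2_norm (slab_boundary L) u)\<^sup>2"
proof -
  let ?d = "partial_deriv (1, 0) u"
  define F where "F p = (fst p - 1 / 2) * (u p * u p)" for p :: point
  have [simp]: "smooth F" unfolding F_def
    by (intro smooth_mult smooth_diff smooth_const u smooth_bounded_linear bounded_linear_fst)
  have d: "smooth ?d" by (intro smooth_partial_deriv u e1_Basis)
  have F': "partial_deriv (1, 0) F p = (u p)\<^sup>2 + 2 * (fst p - 1 / 2) * (u p * ?d p)" for p
  proof -
    have "(F has_derivative (\<lambda>h. (fst p - 1 / 2) * (u p * frechet_derivative u (at p) h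
        + frechet_derivative u (at p) h * u p) + fst h * (u p * u p))) (at p)"
      unfolding F_def by (auto intro!: derivative_eq_intros smooth_has_derivative[OF u])
    from partial_deriv_eq[OF this, of "(1, 0)"] show ?thesis
      by (simp add: partial_deriv_def power2_eq_square algebra_simps)
  qed
  have uL: "u \<in> L2 (slab L)" "?d \<in> L2 (slab L)"
    by (intro continuous_L2_slab smooth_continuous u d)+
  have uT: "(\<lambda>w. u (x, w)) \<in> L2 (torus L)" for x
    by (intro continuous_L2_torus continuous_slice smooth_continuous u)
  have iF: "integrable (slab L) (partial_deriv (1, 0) F)"
    by (intro continuous_integrable_slab smooth_continuous smooth_partial_deriv e1_Basis) simp
  have "(\<integral>p. partial_deriv (1, 0) F p \<partial>slab L) = (\<integral>w. F (1, w) - F (0, w) \<partial>torus L)"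
    using integral_slab_iterated[OF iF] by (simp add: integral_slice_FTC)
  also have "\<dots> = (\<integral>w. (1 / 2) * (norm (u (0, w)))\<^sup>2 + (1 / 2) * (norm (u (1, w)))\<^sup>2 \<partial>torus L)"
    by (simp add: F_def power2_eq_square add.commute)
  also have "\<dots> = (1 / 2) * (L2_norm (slab_boundary L) u)\<^sup>2"
    unfolding L2_boundary(2)[OF uT] unfolding L2_norm_sq using L2_D(2)[OF uT] by simp
  finally have bdry: "(\<integral>p. partial_deriv (1, 0) F p \<partial>slab L) = (1 / 2) * (L2_norm (slab_boundary L) u)\<^sup>2" .
  have le: "(1 / 2) * (norm (u p))\<^sup>2 \<le> partial_deriv (1, 0) F p + (1 / 2) * (norm (?d p))\<^sup>2"
    if "p \<in> space (slab L)" for p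
  proof -
    have "\<bar>2 * (fst p - 1 / 2)\<bar> \<le> 1" using that by (auto simp: space_slab)
    then have "\<bar>2 * (fst p - 1 / 2) * (u p * ?d p)\<bar> \<le> 1 * \<bar>u p * ?d p\<bar>"
      unfolding abs_mult[of "2 * (fst p - 1 / 2)"] by (rule mult_right_mono) simp
    moreover have "2 * \<bar>u p * ?d p\<bar> \<le> (u p)\<^sup>2 + (?d p)\<^sup>2"
      using sum_squares_bound[of "\<bar>u p\<bar>" "\<bar>?d p\<bar>"] by (simp add: abs_mult)
    ultimately show ?thesis by (simp add: F')
  qed
  have "(\<integral>p. (1 / 2) * (norm (u p))\<^sup>2 \<partial>slab L)
      \<le> (\<integral>p. partial_deriv (1, 0) F p + (1 / 2) * (norm (?d p))\<^sup>2 \<partial>slab L)"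
    by (intro integral_mono le Bochner_Integration.integrable_add iF integrable_mult_right L2_D(2) uL)
  also have "\<dots> = (\<integral>p. partial_deriv (1, 0) F p \<partial>slab L) + (\<integral>p. (1 / 2) * (norm (?d p))\<^sup>2 \<partial>slab L)"
    by (intro Bochner_Integration.integral_add iF integrable_mult_right L2_D(2) uL)
  finally show ?thesis
    unfolding bdry by (simp add: L2_norm_sq del: real_norm_def)
qed

section \<open>Linear combinations of a family\<close>

inductive_set lincomb :: "('i \<Rightarrow> 'a \<Rightarrow> real) \<Rightarrow> ('a \<Rightarrow> real) set" for e where
  base: "e i \<in> lincomb e"
| scale: "f \<in> lincomb e \<Longrightarrow> (\<lambda>x. c * f x) \<in> lincomb e"
| add: "f \<in> lincomb e \<Longrightarrow> g \<in> lincomb e \<Longrightarrow> (\<lambda>x. f x + g x) \<in> lincomb e"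

lemma lincomb_diff: "f \<in> lincomb e \<Longrightarrow> g \<in> lincomb e \<Longrightarrow> (\<lambda>x. f x - g x) \<in> lincomb e"
  using lincomb.add[of f e "\<lambda>x. (-1) * g x"] lincomb.scale[of g e "-1"] by simp

lemma lincomb_finite_sum:
  assumes "f \<in> lincomb e"
  shows "\<exists>F c. finite F \<and> f = (\<lambda>x. \<Sum>i\<in>F. c i * e i x)"
  using assms
proof induction
  case (base i)
  show ?case by (intro exI[of _ "{i}"] exI[of _ "\<lambda>_. 1"]) simp
next
  case (scale f a)
  then obtain F c where "finite F" "f = (\<lambda>x. \<Sum>i\<in>F. c i * e i x)" by blast
  then show ?case
    by (intro exI[of _ F] exI[of _ "\<lambda>i. a * c i"]) (simp add: sum_distrib_left mult.assoc)
next
  case (add f g)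
  then obtain F c G d where F: "finite F" "f = (\<lambda>x. \<Sum>i\<in>F. c i * e i x)"
    and G: "finite G" "g = (\<lambda>x. \<Sum>i\<in>G. d i * e i x)" by blast
  define c' d' where "c' i = (if i \<in> F then c i else 0)" and "d' i = (if i \<in> G then d i else 0)" for i
  have "f x = (\<Sum>i\<in>F \<union> G. c' i * e i x)" "g x = (\<Sum>i\<in>F \<union> G. d' i * e i x)" for x
    unfolding F(2) G(2) c'_def d'_def using F(1) G(1)
    by (auto intro!: sum.mono_neutral_cong_left)
  then show ?case using F(1) G(1)
    by (intro exI[of _ "F \<union> G"] exI[of _ "\<lambda>i. c' i + d' i"]) (simp add: algebra_simps sum.distrib)
qed

lemma lincomb_bilinear:
  assumes prod: "\<And>i j. (\<lambda>x. d i (p x) * e j (q x)) \<in> lincomb b"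
    and f: "f \<in> lincomb d" and g: "g \<in> lincomb e"
  shows "(\<lambda>x. f (p x) * g (q x)) \<in> lincomb b"
  using f
proof induction
  case (base i)
  from g show ?case
  proof induction
    case (base j)
    then show ?case using prod[of i j] by simp
  next
    case (scale g c)
    then show ?case using lincomb.scale[OF scale.IH, of c] by (simp add: algebra_simps)
  next
    case (add g h)
    then show ?case using lincomb.add[OF add.IH] by (simp add: algebra_simps)
  qed
next
  case (scale f c)
  then show ?case using lincomb.scale[OF scale.IH, of c] by (simp add: algebra_simps)
next
  case (add f h)
  then show ?case using lincomb.add[OF add.IH] by (simp add: algebra_simps)
qed

section \<open>Trigonometric modes on the slab\<close>

definition cosine :: "nat \<Rightarrow> real \<Rightarrow> real" where "cosine k x = cos (real k * pi * x)"
definition sine :: "nat \<Rightarrow> real \<Rightarrow> real" where "sine k x = sin (real k * pi * x)"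

text \<open>Hartley's function \<open>cas t = cos t + sin t\<close> at the frequencies of the torus. One real family indexed by the integers
  replaces the sines and cosines, and differentiation acts on it by \<open>m \<mapsto> - m\<close> and a factor.\<close>

definition cas :: "real \<Rightarrow> int \<Rightarrow> real \<Rightarrow> real" where
  "cas L m y = cos (2 * pi * of_int m * y / L) + sin (2 * pi * of_int m * y / L)"

text \<open>The parameter \<open>b\<close> is \<^const>\<open>cosine\<close> or \<^const>\<open>sine\<close>. The cosine modes expand \<open>\<zeta>\<close> and its tangential derivatives; the
  normal derivative turns them into sine modes.\<close>

definition mode :: "(nat \<Rightarrow> real \<Rightarrow> real) \<Rightarrow> real \<Rightarrow> nat \<times> int \<times> int \<Rightarrow> point \<Rightarrow> real" where
  "mode b L i p = b (fst i) (fst p) * (cas L (fst (snd i)) (fst (snd p)) * cas L (snd (snd i)) (snd (snd p)))"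

lemma cas_0 [simp]: "cas L 0 y = 1"
  by (simp add: cas_def)

lemma cosine_0 [simp]: "cosine 0 x = 1"
  by (simp add: cosine_def)

lemma cosine_mult: "cosine j x * cosine k x = (cosine (j + k) x + cosine (nat \<bar>int j - int k\<bar>) x) / 2"
proof -
  have "real (nat \<bar>int j - int k\<bar>) = \<bar>real j - real k\<bar>" by simp
  then have "cosine (nat \<bar>int j - int k\<bar>) x = cos (\<bar>real j - real k\<bar> * (pi * x))"
    by (simp add: cosine_def mult.assoc)
  also have "\<dots> = cos (real j * pi * x - real k * pi * x)"
    using cos_minus[of "real j * pi * x - real k * pi * x"]
    by (cases "j \<le> k") (simp_all add: abs_if algebra_simps)
  finally show ?thesis
    by (simp add: cosine_def cos_times_cos algebra_simps)
qed

lemma sine_mult_cosine: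
  "sine j x * cosine k x = (sine (j + k) x + (if k \<le> j then sine (j - k) x else - sine (k - j) x)) / 2"
proof -
  let ?a = "real j * pi * x" and ?b = "real k * pi * x"
  have "sin (?a - ?b) = (if k \<le> j then sine (j - k) x else - sine (k - j) x)"
    using sin_minus[of "?b - ?a"] by (auto simp: sine_def of_nat_diff left_diff_distrib)
  moreover have "sin (?a + ?b) = sine (j + k) x"
    by (simp add: sine_def distrib_right)
  ultimately show ?thesis
    by (simp only: cosine_def sine_def[of j] sin_times_cos)
qed

lemma cas_mult: "cas L m y * cas L n y = (cas L (m - n) y + cas L (n - m) y + cas L (m + n) y - cas L (- m - n) y) / 2"
proof -
  let ?a = "2 * pi * of_int m * y / L" and ?b = "2 * pi * of_int n * y / L"
  have "cas L (m - n) y = cos (?a - ?b) + sin (?a - ?b)" "cas L (n - m) y = cos (?b - ?a) + sin (?b - ?a)"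
    "cas L (m + n) y = cos (?a + ?b) + sin (?a + ?b)" "cas L (- m - n) y = cos (- ?a - ?b) + sin (- ?a - ?b)"
    by (simp_all add: cas_def algebra_simps diff_divide_distrib add_divide_distrib)
  then show ?thesis
    by (simp add: cas_def[of L m] cas_def[of L n] cos_add sin_add cos_diff sin_diff algebra_simps)
qed

lemma cosine_mult_lincomb: "(\<lambda>x. cosine j x * cosine k x) \<in> lincomb cosine"
proof -
  have "(\<lambda>x. (1 / 2) * (cosine (j + k) x + cosine (nat \<bar>int j - int k\<bar>) x)) \<in> lincomb cosine"
    by (intro lincomb.intros)
  then show ?thesis by (simp add: cosine_mult)
qed

lemma sine_mult_lincomb: "(\<lambda>x. sine j x * cosine k x) \<in> lincomb sine"
proof -
  have "(\<lambda>x. (1 / 2) * (sine (j + k) x + (1 * sine (j - k) x))) \<in> lincomb sine"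
    "(\<lambda>x. (1 / 2) * (sine (j + k) x + ((-1) * sine (k - j) x))) \<in> lincomb sine"
    by (intro lincomb.intros)+
  then show ?thesis unfolding sine_mult_cosine by (cases "k \<le> j") simp_all
qed

lemma cas_mult_lincomb: "(\<lambda>y. cas L m y * cas L n y) \<in> lincomb (cas L)"
proof -
  have "(\<lambda>y. (1 / 2) * (cas L (m - n) y + cas L (n - m) y + cas L (m + n) y - cas L (- m - n) y)) \<in> lincomb (cas L)"
    by (intro lincomb.intros lincomb_diff)
  then show ?thesis by (simp add: cas_mult)
qed

lemma lincomb_tensor:
  assumes f: "f \<in> lincomb b" and g: "g \<in> lincomb (cas L)" and h: "h \<in> lincomb (cas L)"
  shows "(\<lambda>p. f (fst p) * (g (fst (snd p)) * h (snd (snd p)))) \<in> lincomb (mode b L)"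
proof -
  let ?e = "\<lambda>(m, n) w. cas L m (fst w) * cas L n (snd w)"
  have gh: "(\<lambda>w. g (fst w) * h (snd w)) \<in> lincomb ?e"
  proof (rule lincomb_bilinear[OF _ g h])
    show "(\<lambda>x. cas L i (fst x) * cas L j (snd x)) \<in> lincomb ?e" for i j
      using lincomb.base[of ?e "(i, j)"] by simp
  qed
  show ?thesis
  proof (rule lincomb_bilinear[where p = fst and q = snd, OF _ f gh])
    show "(\<lambda>x. b i (fst x) * ?e j (snd x)) \<in> lincomb (mode b L)" for i j
      using lincomb.base[of "mode b L" "(i, j)"] by (simp add: mode_def[abs_def] case_prod_beta)
  qed
qed

lemma mode_mult_lincomb:
  assumes b: "\<And>j k. (\<lambda>x. b j x * cosine k x) \<in> lincomb b"
    and f: "f \<in> lincomb (mode b L)" and g: "g \<in> lincomb (mode cosine L)"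
  shows "(\<lambda>p. f p * g p) \<in> lincomb (mode b L)"
proof (rule lincomb_bilinear[where p = "\<lambda>x. x" and q = "\<lambda>x. x", OF _ f g])
  fix i j :: "nat \<times> int \<times> int"
  show "(\<lambda>p. mode b L i p * mode cosine L j p) \<in> lincomb (mode b L)"
    using lincomb_tensor[OF b[of "fst i" "fst j"] cas_mult_lincomb[of L "fst (snd i)" "fst (snd j)"]
        cas_mult_lincomb[of L "snd (snd i)" "snd (snd j)"]]
    by (simp add: mode_def mult_ac)
qed

section \<open>Density of the modes\<close>

definition slab_embedding :: "real \<Rightarrow> point \<Rightarrow> real \<times> real \<times> real \<times> real \<times> real" where
  "slab_embedding L p = (cos (pi * fst p),
     cos (2 * pi * fst (snd p) / L), sin (2 * pi * fst (snd p) / L),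
     cos (2 * pi * snd (snd p) / L), sin (2 * pi * snd (snd p) / L))"

text \<open>Product-to-sum formulas make the combinations of cosine modes an algebra, and it contains the five coordinates.\<close>

lemma polynomial_slab_embedding:
  assumes "real_polynomial_function q"
  shows "(\<lambda>p. q (slab_embedding L p)) \<in> lincomb (mode cosine L)"
proof -
  have cos1: "(\<lambda>x. 1) \<in> lincomb cosine" using lincomb.base[of cosine 0] by (simp add: cosine_def[abs_def])
  have cas1: "(\<lambda>y. 1) \<in> lincomb (cas L)" using lincomb.base[of "cas L" 0] by (simp add: cas_def[abs_def])
  have C: "(\<lambda>x. cos (pi * x)) \<in> lincomb cosine"
    using lincomb.base[of cosine 1] by (simp add: cosine_def[abs_def])
  have "(\<lambda>y. (1 / 2) * (cas L 1 y + cas L (- 1) y)) \<in> lincomb (cas L)"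
    "(\<lambda>y. (1 / 2) * (cas L 1 y - cas L (- 1) y)) \<in> lincomb (cas L)"
    by (intro lincomb.intros lincomb_diff)+
  then have cs: "(\<lambda>y. cos (2 * pi * y / L)) \<in> lincomb (cas L)" "(\<lambda>y. sin (2 * pi * y / L)) \<in> lincomb (cas L)"
    by (simp_all add: cas_def)
  have one: "(\<lambda>_. 1) \<in> lincomb (mode cosine L)"
    using lincomb_tensor[OF cos1 cas1 cas1] by simp
  note coord = lincomb_tensor[OF C cas1 cas1] lincomb_tensor[OF cos1 cs(1) cas1] lincomb_tensor[OF cos1 cs(2) cas1]
    lincomb_tensor[OF cos1 cas1 cs(1)] lincomb_tensor[OF cos1 cas1 cs(2)]
  show ?thesis
    using assms
  proof induction
    case (linear q)
    then interpret bounded_linear q .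
    have q: "q (a, b, c, d, e) = q (1,0,0,0,0) * a + (q (0,1,0,0,0) * b + (q (0,0,1,0,0) * c + (q (0,0,0,1,0) * d + q (0,0,0,0,1) * e)))"
      for a b c d e
    proof -
      have "q (a, b, c, d, e) = q (a *\<^sub>R (1,0,0,0,0) + (b *\<^sub>R (0,1,0,0,0) + (c *\<^sub>R (0,0,1,0,0)
        + (d *\<^sub>R (0,0,0,1,0) + e *\<^sub>R (0,0,0,0,1)))))" by simp
      also have "\<dots> = a * q (1,0,0,0,0) + (b * q (0,1,0,0,0) + (c * q (0,0,1,0,0)
        + (d * q (0,0,0,1,0) + e * q (0,0,0,0,1))))"
        unfolding add scaleR by simp
      finally show ?thesis by (simp add: mult.commute)
    qed
    have "(\<lambda>p. q (1,0,0,0,0) * cos (pi * fst p)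
        + (q (0,1,0,0,0) * cos (2 * pi * fst (snd p) / L) + (q (0,0,1,0,0) * sin (2 * pi * fst (snd p) / L)
        + (q (0,0,0,1,0) * cos (2 * pi * snd (snd p) / L) + q (0,0,0,0,1) * sin (2 * pi * snd (snd p) / L)))))
      \<in> lincomb (mode cosine L)"
      using lincomb.add[OF lincomb.scale[OF coord(1)] lincomb.add[OF lincomb.scale[OF coord(2)]
          lincomb.add[OF lincomb.scale[OF coord(3)] lincomb.add[OF lincomb.scale[OF coord(4)]
          lincomb.scale[OF coord(5)]]]], of "q (1,0,0,0,0)" "q (0,1,0,0,0)" "q (0,0,1,0,0)" "q (0,0,0,1,0)" "q (0,0,0,0,1)"]
      by (simp only: mult_1_left mult_1_right)
    then show ?case
      unfolding slab_embedding_def by (subst q)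
  next
    case (const c)
    then show ?case using lincomb.scale[OF one, of c] by simp
  next
    case (add f g)
    then show ?case by (intro lincomb.add)
  next
    case (mult f g)
    then show ?case by (intro mode_mult_lincomb cosine_mult_lincomb)
  qed
qed

text \<open>The inverse of \<open>y \<mapsto> (cos (2 * pi * y / L), sin (2 * pi * y / L))\<close> on \<open>[0, L)\<close>; the truncation makes
  it Borel on the whole plane.\<close>

definition circle_coordinate :: "real \<Rightarrow> real \<Rightarrow> real \<Rightarrow> real" where
  "circle_coordinate L c s = (let a = arccos (max (-1) (min 1 c)) in
     (if 0 \<le> s then a else 2 * pi - a) * L / (2 * pi))"

lemma circle_coordinate:
  assumes L: "0 < L" and y: "y \<in> {0..<L}"
  shows "circle_coordinate L (cos (2 * pi * y / L)) (sin (2 * pi * y / L)) = y"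
proof -
  define t where "t = 2 * pi * y / L"
  have t: "0 \<le> t" "t < 2 * pi" "t * L / (2 * pi) = y"
    using L y by (auto simp: t_def field_simps)
  show ?thesis
  proof (cases "t \<le> pi")
    case True
    then have "0 \<le> sin t" using t by (intro sin_ge_zero) auto
    then show ?thesis
      using t True by (simp add: circle_coordinate_def t_def[symmetric] arccos_cos)
  next
    case False
    then have "sin t < 0" using t by (intro sin_lt_zero) auto
    moreover have "arccos (cos t) = 2 * pi - t"
      using arccos_cos[of "2 * pi - t"] False t by (simp add: cos_diff)
    ultimately show ?thesis
      using t by (simp add: circle_coordinate_def t_def[symmetric])
  qed
qed

lemma borel_measurable_arccos_truncated: "(\<lambda>c::real. arccos (max (-1) (min 1 c))) \<in> borel_measurable borel"
  by (intro borel_measurable_continuous_onI continuous_on_arccos continuous_intros) auto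

definition slab_coordinates :: "real \<Rightarrow> real \<times> real \<times> real \<times> real \<times> real \<Rightarrow> point" where
  "slab_coordinates L = (\<lambda>(a, b, c, d, e).
     (arccos (max (-1) (min 1 a)) / pi, circle_coordinate L b c, circle_coordinate L d e))"

lemma slab_coordinates_embedding:
  assumes "0 < L" "p \<in> space (slab L)"
  shows "slab_coordinates L (slab_embedding L p) = p"
proof -
  obtain x y z where p: "p = (x, y, z)" "0 < x" "x < 1" "y \<in> {0..<L}" "z \<in> {0..<L}"
    using assms(2) by (cases p) (auto simp: space_slab)
  have "arccos (cos (pi * x)) = pi * x"
    using p by (intro arccos_cos) auto
  then show ?thesis
    using p circle_coordinate[OF assms(1)] by (simp add: slab_coordinates_def slab_embedding_def)
qed

lemma borel_measurable_slab_coordinates: "slab_coordinates L \<in> borel_measurable borel"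
proof -
  note [measurable] = borel_measurable_arccos_truncated
  have circle: "(\<lambda>v. circle_coordinate L (c v) (d v)) \<in> borel_measurable borel"
    if "continuous_on UNIV c" "continuous_on UNIV d"
    for c d :: "real \<times> real \<times> real \<times> real \<times> real \<Rightarrow> real"
  proof -
    have [measurable]: "c \<in> borel_measurable borel" "d \<in> borel_measurable borel"
      using that by (auto intro: borel_measurable_continuous_onI)
    show ?thesis unfolding circle_coordinate_def Let_def by measurable
  qed
  have fst: "(\<lambda>v. arccos (max (-1) (min 1 (fst v))) / pi)
      \<in> borel_measurable (borel :: (real \<times> real \<times> real \<times> real \<times> real) measure)"
    by (intro borel_measurable_divide measurable_compose[OF _ borel_measurable_arccos_truncated]
        borel_measurable_continuous_onI continuous_intros borel_measurable_const)
  show ?thesis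
    unfolding slab_coordinates_def case_prod_beta
    by (intro borel_measurable_Pair fst circle continuous_intros)
qed

lemma continuous_slab_embedding: "continuous_on UNIV (slab_embedding L)"
  unfolding slab_embedding_def divide_inverse by (intro continuous_intros)

lemma continuous_cosine: "continuous_on UNIV (cosine k)"
  and continuous_sine: "continuous_on UNIV (sine k)"
  and continuous_cas: "continuous_on UNIV (cas L m)"
  unfolding cosine_def sine_def cas_def divide_inverse by (intro continuous_intros)+

lemma continuous_mode:
  assumes "\<And>k. continuous_on UNIV (b k)"
  shows "continuous_on UNIV (mode b L i)"
proof -
  have "continuous_on UNIV (\<lambda>p::point. b k (fst p))" for k
    using continuous_on_compose2[OF assms continuous_on_fst[OF continuous_on_id]] by simp
  moreover have "continuous_on UNIV (\<lambda>p::point. cas L m (fst (snd p)))"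
    "continuous_on UNIV (\<lambda>p::point. cas L m (snd (snd p)))" for m
    using continuous_on_compose2[OF continuous_cas continuous_on_fst[OF continuous_on_snd[OF continuous_on_id]]]
      continuous_on_compose2[OF continuous_cas continuous_on_snd[OF continuous_on_snd[OF continuous_on_id]]] by simp_all
  ultimately show ?thesis
    unfolding mode_def by (intro continuous_on_mult)
qed

lemma lincomb_continuous: "f \<in> lincomb e \<Longrightarrow> (\<And>i. continuous_on UNIV (e i)) \<Longrightarrow> continuous_on UNIV f"
  by (induction rule: lincomb.induct) (auto intro!: continuous_intros)

text \<open>Through \<^const>\<open>slab_embedding\<close> the slab becomes a Borel subset of a compact set on which the
  modes are polynomials, so density of polynomials applies to the image measure.\<close>

lemma cosine_modes_dense:
  assumes L: "0 < L" and f: "f \<in> L2 (slab L)" and e: "0 < e"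
  shows "\<exists>p\<in>lincomb (mode cosine L). L2_norm (slab L) (\<lambda>x. f x - p x) < e"
proof -
  let ?S = "space (slab L)" and ?E = "slab_embedding L"
  define \<nu> where "\<nu> = distr (slab L) borel ?E"
  have S: "?S \<in> sets borel" by (simp add: space_slab borel_Times)
  have E[measurable]: "?E \<in> borel_measurable (slab L)"
    using L2_D(1)[OF continuous_L2_slab[OF continuous_slab_embedding]] .
  \<comment> \<open>\<open>f\<close> is measurable on the slab only; extension by zero makes its transport to the image Borel.\<close>
  define g where "g v = indicator ?S (slab_coordinates L v) * f (slab_coordinates L v)" for v
  have "(\<lambda>x. indicator ?S x * f x) \<in> borel_measurable lborel"
    using L2_D(1)[OF f] S by (simp add: slab_def space_restrict_space borel_measurable_restrict_space_iff)
  then have g[measurable]: "g \<in> borel_measurable borel"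
    unfolding g_def using measurable_compose[OF borel_measurable_slab_coordinates] by simp
  have gE: "g (?E x) = f x" if "x \<in> ?S" for x
    using slab_coordinates_embedding[OF L that] that by (simp add: g_def)
  have norm_eq: "L2_norm \<nu> (\<lambda>v. g v - q v) = L2_norm (slab L) (\<lambda>x. f x - q (?E x))"
    if [measurable]: "q \<in> borel_measurable borel" for q
    unfolding \<nu>_def L2_norm_def using gE
    by (subst integral_distr) (auto intro!: arg_cong[where f = sqrt] Bochner_Integration.integral_cong)
  have "g \<in> L2 \<nu>"
  proof -
    have "integrable (slab L) (\<lambda>x. (norm (g (?E x)))\<^sup>2)"
      using L2_D(2)[OF f] by (subst Bochner_Integration.integrable_cong[OF refl]) (auto simp: gE)
    then show ?thesis by (simp add: L2_def \<nu>_def integrable_distr_eq)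
  qed
  define K :: "(real \<times> real \<times> real \<times> real \<times> real) set" where
    "K = {-1..1} \<times> {-1..1} \<times> {-1..1} \<times> {-1..1} \<times> {-1..1}"
  have K: "compact K" unfolding K_def by (intro compact_Times compact_Icc)
  have EK: "?E x \<in> K" for x by (simp add: K_def slab_embedding_def)
  have "AE v in \<nu>. v \<in> K"
    unfolding \<nu>_def using K EK by (subst AE_distr_iff) (auto simp: borel_compact)
  moreover have "finite_measure \<nu>"
    unfolding \<nu>_def using finite_measure.finite_measure_distr[OF finite_slab E] .
  ultimately obtain q where q: "real_polynomial_function q" "L2_norm \<nu> (\<lambda>v. g v - q v) < e"
    using polynomials_dense_L2[of \<nu> K g e] K e \<open>g \<in> L2 \<nu>\<close> by (auto simp: \<nu>_def)
  have "q \<in> borel_measurable borel"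
    using q(1) by (intro borel_measurable_continuous_onI) (simp add: continuous_on_polymonial_function real_polynomial_function_eq)
  then show ?thesis
    using q norm_eq polynomial_slab_embedding[OF q(1), of L] by (intro bexI[of _ "\<lambda>p. q (?E p)"]) auto
qed

text \<open>Away from \<open>x = 0\<close> and \<open>x = 1\<close> one may divide by \<open>sin (pi * x)\<close>, which carries the cosine modes
  to combinations of sine modes.\<close>

lemma sine_modes_dense:
  assumes L: "0 < L" and f: "f \<in> L2 (slab L)" and e: "0 < e"
  shows "\<exists>p\<in>lincomb (mode sine L). L2_norm (slab L) (\<lambda>x. f x - p x) < e"
proof -
  define s where "s p = sin (pi * fst p)" for p :: point
  define u where "u n p = (if 1 / real (Suc n) < s p then f p else 0)" for n p
  have s_mode: "s = mode sine L (1, 0, 0)"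
    by (auto simp: s_def mode_def sine_def)
  have sc: "continuous_on UNIV s" unfolding s_def by (intro continuous_intros)
  have [measurable]: "s \<in> borel_measurable (slab L)" using L2_D(1)[OF continuous_L2_slab[OF sc]] .
  note [measurable] = L2_D(1)[OF f]
  have um[measurable]: "u n \<in> borel_measurable (slab L)" for n unfolding u_def by measurable
  have lim: "(\<lambda>n. u n p) \<longlonglongrightarrow> f p" if "p \<in> space (slab L)" for p
  proof (rule tendsto_eventually)
    have "0 < s p" using that by (auto simp: s_def space_slab intro!: sin_gt_zero)
    then have "\<forall>\<^sub>F n in sequentially. 1 / real (Suc n) < s p"
      using LIMSEQ_inverse_real_of_nat by (intro order_tendstoD) (simp_all add: divide_inverse)
    then show "\<forall>\<^sub>F n in sequentially. u n p = f p"
      by eventually_elim (simp add: u_def)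
  qed
  have af: "(\<lambda>x. \<bar>f x\<bar>) \<in> L2 (slab L)"
    by (rule L2_dominated[OF f, of _ 1]) auto
  have bound: "norm (u n x) \<le> \<bar>f x\<bar>" for n x by (simp add: u_def)
  note conv = L2_dominated_convergence[OF af L2_D(1)[OF f] um bound lim]
  have L2s: "p \<in> L2 (slab L)" if "p \<in> lincomb (mode sine L)" for p
    by (intro continuous_L2_slab lincomb_continuous[OF that] continuous_mode continuous_sine)
  have "\<exists>p. p \<in> lincomb (mode sine L) \<and> L2_norm (slab L) (\<lambda>x. u n x - p x) < d" if "0 < d" for n d
  proof -
    define v where "v p = u n p / s p" for p
    have vL: "v \<in> L2 (slab L)"
    proof (rule L2_dominated[OF f, of _ "real (Suc n)"])
      show "v \<in> borel_measurable (slab L)" unfolding v_def by measurable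
      show "AE x in slab L. norm (v x) \<le> real (Suc n) * norm (f x)"
      proof (rule AE_I2)
        fix x
        show "norm (v x) \<le> real (Suc n) * norm (f x)"
        proof (cases "1 / real (Suc n) < s x")
          case True
          then have "0 < s x" by (rule le_less_trans[rotated]) simp
          have "1 \<le> real (Suc n) * s x" using True by (simp add: field_simps del: of_nat_Suc)
          then have "\<bar>f x\<bar> * 1 \<le> \<bar>f x\<bar> * (real (Suc n) * s x)" by (intro mult_left_mono) auto
          then show ?thesis using True \<open>0 < s x\<close>
            by (simp add: v_def u_def pos_divide_le_eq mult_ac del: of_nat_Suc)
        qed (simp add: v_def u_def)
      qed
    qed
    obtain p where p: "p \<in> lincomb (mode cosine L)" "L2_norm (slab L) (\<lambda>x. v x - p x) < d"
      using cosine_modes_dense[OF L vL \<open>0 < d\<close>] by blast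
    have sp: "(\<lambda>x. s x * p x) \<in> lincomb (mode sine L)"
      unfolding s_mode using p(1) by (intro mode_mult_lincomb sine_mult_lincomb lincomb.base)
    have pL: "p \<in> L2 (slab L)"
      by (intro continuous_L2_slab lincomb_continuous[OF p(1)] continuous_mode continuous_cosine)
    have "L2_norm (slab L) (\<lambda>x. u n x - s x * p x) \<le> L2_norm (slab L) (\<lambda>x. v x - p x)"
    proof (rule L2_norm_mono[OF L2_diff[OF conv(2) L2s[OF sp]] L2_diff[OF vL pL]])
      show "AE x in slab L. norm (u n x - s x * p x) \<le> norm (v x - p x)"
      proof (rule AE_I2)
        fix x assume "x \<in> space (slab L)"
        then have "s x \<noteq> 0" using sin_gt_zero[of "pi * fst x"] by (auto simp: s_def space_slab)
        then have "u n x - s x * p x = s x * (v x - p x)" by (simp add: v_def algebra_simps)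
        moreover have "\<bar>s x\<bar> \<le> 1" by (simp add: s_def)
        ultimately show "norm (u n x - s x * p x) \<le> norm (v x - p x)"
          by (simp add: abs_mult mult_left_le_one_le)
      qed
    qed
    then show ?thesis using p(2) sp by (intro exI[of _ "\<lambda>x. s x * p x"]) auto
  qed
  from L2_approx_limit[where P = "\<lambda>p. p \<in> lincomb (mode sine L)" and u = u, OF conv(2) f L2s conv(3) this e]
  show ?thesis unfolding Bex_def .
qed

section \<open>Calculus of the modes\<close>

lemma smooth_linear_arg: "smooth (\<lambda>y::real. c * y)"
  by (intro smooth_bounded_linear bounded_linear_mult_right)

lemma smooth_cosine: "smooth (cosine k)" and smooth_sine: "smooth (sine k)"
  unfolding cosine_def[abs_def] sine_def[abs_def]
  using smooth_compose[OF smooth_cos smooth_linear_arg] smooth_compose[OF smooth_sin smooth_linear_arg]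
  by simp_all

lemma cas_alt: "cas L m y = cos ((2 * pi * of_int m / L) * y) + sin ((2 * pi * of_int m / L) * y)"
  by (simp add: cas_def)

lemma smooth_cas: "smooth (cas L m)"
  unfolding cas_alt[abs_def]
  by (intro smooth_add smooth_compose[OF smooth_cos smooth_linear_arg] smooth_compose[OF smooth_sin smooth_linear_arg])

lemma smooth_mode:
  assumes "\<And>k. smooth (b k)"
  shows "smooth (mode b L i)"
proof -
  have lin: "smooth (\<lambda>p::point. fst p)" "smooth (\<lambda>p::point. fst (snd p))" "smooth (\<lambda>p::point. snd (snd p))"
    by (intro smooth_bounded_linear bounded_linear_fst bounded_linear_snd
        bounded_linear_fst_comp bounded_linear_snd_comp)+
  show ?thesis
    unfolding mode_def[abs_def]
    by (rule smooth_mult[OF smooth_compose[OF assms lin(1)]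
          smooth_mult[OF smooth_compose[OF smooth_cas lin(2)] smooth_compose[OF smooth_cas lin(3)]]])
qed

lemma cosine_deriv: "(cosine k has_real_derivative - (real k * pi) * sine k x) (at x)"
  and sine_deriv: "(sine k has_real_derivative real k * pi * cosine k x) (at x)"
  unfolding cosine_def[abs_def] sine_def[abs_def] by (auto intro!: derivative_eq_intros)

lemma cas_deriv: "(cas L m has_real_derivative 2 * pi * of_int m / L * cas L (- m) y) (at y)"
proof -
  define c where "c = 2 * pi * of_int m / L"
  have eq: "cas L m = (\<lambda>y. cos (c * y) + sin (c * y))" "cas L (- m) y = cos (c * y) - sin (c * y)"
    by (simp_all add: cas_alt[abs_def] c_def)
  show ?thesis
    unfolding eq c_def[symmetric]
    by (rule derivative_eq_intros refl)+ (simp add: algebra_simps)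
qed

lemma cas_periodic: "0 < L \<Longrightarrow> cas L m (y + L) = cas L m y"
proof -
  assume "0 < L"
  then have "2 * pi * of_int m * (y + L) / L = 2 * pi * of_int m * y / L + of_int m * (2 * pi)"
    by (simp add: field_simps)
  then show ?thesis
    using sin.plus_of_int[of "2 * pi * of_int m * y / L" m] cos.plus_of_int[of "2 * pi * of_int m * y / L" m]
    by (simp add: cas_def)
qed

lemma torus_periodic_mode: "0 < L \<Longrightarrow> torus_periodic L (mode b L i)"
  by (simp add: torus_periodic_def mode_def cas_periodic)

lemma has_derivative_separated:
  fixes f g h :: "real \<Rightarrow> real"
  assumes "(f has_real_derivative f') (at (fst p))" "(g has_real_derivative g') (at (fst (snd p)))"
    "(h has_real_derivative h') (at (snd (snd p)))"
  shows "((\<lambda>p::point. f (fst p) * (g (fst (snd p)) * h (snd (snd p)))) has_derivative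
    (\<lambda>v. f (fst p) * (g (fst (snd p)) * (h' * snd (snd v)) + g' * fst (snd v) * h (snd (snd p)))
       + f' * fst v * (g (fst (snd p)) * h (snd (snd p))))) (at p)"
proof -
  have "((\<lambda>p::point. fst p) has_derivative fst) (at p)"
    "((\<lambda>p::point. fst (snd p)) has_derivative (\<lambda>v. fst (snd v))) (at p)"
    "((\<lambda>p::point. snd (snd p)) has_derivative (\<lambda>v. snd (snd v))) (at p)"
    by (intro bounded_linear_imp_has_derivative bounded_linear_fst bounded_linear_snd
        bounded_linear_fst_comp bounded_linear_snd_comp)+
  note d = this(1)[THEN has_derivative_compose, OF assms(1)[unfolded has_field_derivative_def]]
    this(2)[THEN has_derivative_compose, OF assms(2)[unfolded has_field_derivative_def]]
    this(3)[THEN has_derivative_compose, OF assms(3)[unfolded has_field_derivative_def]]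
  show ?thesis
    by (rule has_derivative_mult[OF d(1) has_derivative_mult[OF d(2,3)]])
qed

lemma partial_deriv_mode_normal:
  "partial_deriv (1, 0) (mode cosine L i) p = - (real (fst i) * pi) * mode sine L i p"
  "partial_deriv (1, 0) (mode sine L i) p = real (fst i) * pi * mode cosine L i p"
  using partial_deriv_eq[OF has_derivative_separated[where p = p, OF cosine_deriv[of "fst i"]
        cas_deriv[of L "fst (snd i)"] cas_deriv[of L "snd (snd i)"]], of "(1, 0)"]
    partial_deriv_eq[OF has_derivative_separated[where p = p, OF sine_deriv[of "fst i"]
        cas_deriv[of L "fst (snd i)"] cas_deriv[of L "snd (snd i)"]], of "(1, 0)"]
  by (simp_all add: mode_def[abs_def])

lemma partial_deriv_mode_tangential:
  "partial_deriv (0, 1, 0) (mode cosine L (k, m, n)) p = 2 * pi * of_int m / L * mode cosine L (k, - m, n) p"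
  "partial_deriv (0, 0, 1) (mode cosine L (k, m, n)) p = 2 * pi * of_int n / L * mode cosine L (k, m, - n) p"
  using partial_deriv_eq[OF has_derivative_separated[where p = p, OF cosine_deriv[of k]
        cas_deriv[of L m] cas_deriv[of L n]], of "(0, 1, 0)"]
    partial_deriv_eq[OF has_derivative_separated[where p = p, OF cosine_deriv[of k]
        cas_deriv[of L m] cas_deriv[of L n]], of "(0, 0, 1)"]
  by (simp_all add: mode_def[abs_def])

section \<open>Orthogonality of the modes\<close>

lemma integral_slab_separated:
  fixes f g h :: "real \<Rightarrow> real"
  assumes f: "continuous_on UNIV f" and g: "continuous_on UNIV g" and h: "continuous_on UNIV h"
  shows "(\<integral>p. f (fst p) * (g (fst (snd p)) * h (snd (snd p))) \<partial>slab L)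
    = (\<integral>x. f x \<partial>unit_line) * ((\<integral>y. g y \<partial>period L) * (\<integral>z. h z \<partial>period L))"
proof -
  have cont: "continuous_on UNIV (\<lambda>p::point. f (fst p) * (g (fst (snd p)) * h (snd (snd p))))"
    by (intro continuous_on_mult continuous_on_compose2[OF f] continuous_on_compose2[OF g]
        continuous_on_compose2[OF h]) (auto intro!: continuous_on_fst continuous_on_snd continuous_on_id)
  have cont2: "continuous_on UNIV (\<lambda>w::real \<times> real. g (fst w) * h (snd w))"
    by (intro continuous_on_mult continuous_on_compose2[OF g] continuous_on_compose2[OF h])
       (auto intro!: continuous_on_fst continuous_on_snd continuous_on_id)
  interpret pair_sigma_finite "period L" "period L"
    using finite_period[of L] by (intro pair_sigma_finite.intro finite_measure.axioms)
  have "integrable (period L \<Otimes>\<^sub>M period L) (\<lambda>(y, z). g y * h z)"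
    using L2_integrable[OF finite_torus continuous_L2_torus[OF cont2, of L]]
    by (simp add: torus_def case_prod_unfold)
  from integral_fst[OF this]
  have "(\<integral>w. g (fst w) * h (snd w) \<partial>torus L) = (\<integral>y. g y \<partial>period L) * (\<integral>z. h z \<partial>period L)"
    by (simp add: torus_def case_prod_unfold)
  then show ?thesis
    using integral_slab_iterated[OF continuous_integrable_slab[OF cont], of L] by simp
qed

lemma integral_cosine: "(\<integral>x. cosine k x \<partial>unit_line) = (if k = 0 then 1 else 0)"
proof (cases "k = 0")
  case True
  then show ?thesis using integral_unit_line_FTC[of "\<lambda>x. x" "\<lambda>_. 1"] by simp
next
  case False
  have "((\<lambda>x. 1 / (real k * pi) * sine k x) has_real_derivative cosine k x) (at x)" for x
    by (rule derivative_eq_intros sine_deriv refl)+ (use False in simp)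
  from integral_unit_line_FTC[OF this continuous_cosine] False show ?thesis
    by (simp add: sine_def)
qed

lemma integral_cas: "0 < L \<Longrightarrow> (\<integral>y. cas L m y \<partial>period L) = (if m = 0 then L else 0)"
proof (cases "m = 0")
  case True
  assume "0 < L"
  with True show ?thesis using integral_period_FTC[of L "\<lambda>x. x" "\<lambda>_. 1"] by simp
next
  case False
  assume L: "0 < L"
  have "((\<lambda>y. - L / (2 * pi * of_int m) * cas L (- m) y) has_real_derivative cas L m y) (at y)" for y
    by (rule derivative_eq_intros cas_deriv refl)+ (use False L in simp)
  from integral_period_FTC[OF _ this continuous_cas] False L cas_periodic[OF L, of "- m" 0] show ?thesis
    by simp
qed

lemma integral_cosine_cosine:
  "(\<integral>x. cosine j x * cosine k x \<partial>unit_line) = (if j = k then if k = 0 then 1 else 1 / 2 else 0)"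
proof -
  have i: "integrable unit_line (cosine k)" for k
    by (intro L2_integrable finite_unit_line continuous_L2_unit_line continuous_cosine)
  show ?thesis
    unfolding cosine_mult using i by (simp add: integral_cosine)
qed

lemma sine_mult: "sine j x * sine k x = (cosine (nat \<bar>int j - int k\<bar>) x - cosine (j + k) x) / 2"
  using cosine_mult[of j x k] by (simp add: cosine_def sine_def distrib_right cos_add)

lemma integral_sine_sine:
  "(\<integral>x. sine j x * sine k x \<partial>unit_line) = (if j = k then if k = 0 then 0 else 1 / 2 else 0)"
proof -
  have i: "integrable unit_line (cosine k)" for k
    by (intro L2_integrable finite_unit_line continuous_L2_unit_line continuous_cosine)
  show ?thesis
    unfolding sine_mult using i by (simp add: integral_cosine)
qed

lemma integral_cas_cas:
  assumes "0 < L"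
  shows "(\<integral>y. cas L m y * cas L n y \<partial>period L) = (if m = n then L else 0)"
proof -
  have i: "integrable (period L) (cas L m)" for m
    by (intro L2_integrable finite_period continuous_L2_period continuous_cas)
  have "- m - n = 0 \<longleftrightarrow> m + n = 0" by linarith
  then show ?thesis
    unfolding cas_mult using i by (simp add: integral_cas[OF assms])
qed

lemma integral_mode_mode:
  assumes L: "0 < L" and b: "\<And>k. continuous_on UNIV (b k)"
  shows "(\<integral>p. mode b L i p * mode b L j p \<partial>slab L)
    = (\<integral>x. b (fst i) x * b (fst j) x \<partial>unit_line) * (if snd i = snd j then L * L else 0)"
proof -
  have "(\<integral>p. mode b L i p * mode b L j p \<partial>slab L)
    = (\<integral>p. (b (fst i) (fst p) * b (fst j) (fst p)) * ((cas L (fst (snd i)) (fst (snd p)) * cas L (fst (snd j)) (fst (snd p)))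
       * (cas L (snd (snd i)) (snd (snd p)) * cas L (snd (snd j)) (snd (snd p)))) \<partial>slab L)"
    by (simp add: mode_def mult_ac)
  also have "\<dots> = (\<integral>x. b (fst i) x * b (fst j) x \<partial>unit_line)
      * ((\<integral>y. cas L (fst (snd i)) y * cas L (fst (snd j)) y \<partial>period L)
       * (\<integral>z. cas L (snd (snd i)) z * cas L (snd (snd j)) z \<partial>period L))"
    by (rule integral_slab_separated) (intro continuous_on_mult b continuous_cas)+
  finally show ?thesis
    by (simp add: integral_cas_cas[OF L] prod_eq_iff)
qed

lemma mode_orthogonal:
  assumes "0 < L" "i \<noteq> j"
  shows "(\<integral>p. mode cosine L i p * mode cosine L j p \<partial>slab L) = 0"
    and "(\<integral>p. mode sine L i p * mode sine L j p \<partial>slab L) = 0"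
  using assms
  by (auto simp: integral_mode_mode continuous_cosine continuous_sine integral_cosine_cosine integral_sine_sine prod_eq_iff)

lemma mode_norm:
  assumes "0 < L"
  shows "(\<integral>p. mode cosine L i p * mode cosine L i p \<partial>slab L) = (if fst i = 0 then 1 else 1 / 2) * (L * L)"
    and "(\<integral>p. mode sine L i p * mode sine L i p \<partial>slab L) = (if fst i = 0 then 0 else 1 / 2) * (L * L)"
  using assms
  by (auto simp: integral_mode_mode continuous_cosine continuous_sine integral_cosine_cosine integral_sine_sine)

section \<open>Integration by parts up to the boundary\<close>

text \<open>Positive only where \<open>x (1 - x) > 1 / (n + 1)\<close>, hence inside a compact part of \<open>(0, 1)\<close>. It tends to \<open>1\<close> without ever being
  equal to it, and this is enough below.\<close>

definition cutoff :: "nat \<Rightarrow> real \<Rightarrow> real" where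
  "cutoff n x = flat 0 (real (Suc n) * (x * (1 - x)) - 1)"

lemma smooth_cutoff: "smooth (cutoff n)"
proof -
  have id: "smooth (\<lambda>x::real. x)" by (intro smooth_bounded_linear bounded_linear_ident)
  show ?thesis
    unfolding cutoff_def[abs_def]
    by (rule smooth_compose[OF smooth_flat smooth_diff[OF smooth_mult[OF smooth_const
          smooth_mult[OF id smooth_diff[OF smooth_const id]]] smooth_const]])
qed

lemma cutoff_deriv:
  "(cutoff n has_real_derivative real (Suc n) * (1 - 2 * x) * flat 2 (real (Suc n) * (x * (1 - x)) - 1)) (at x)"
proof -
  have "(flat 0 has_real_derivative flat 2 t) (at t)" for t
    using flat_deriv[of 0 t] by (simp add: numeral_2_eq_2)
  moreover have "((\<lambda>x. real (Suc n) * (x * (1 - x)) - 1) has_real_derivative real (Suc n) * (1 - 2 * x)) (at x)"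
    by (auto intro!: derivative_eq_intros simp: algebra_simps)
  ultimately show ?thesis
    unfolding cutoff_def[abs_def] mult.commute[of _ "flat 2 _"] by (rule DERIV_chain2)
qed

lemma cutoff_support:
  assumes "cutoff n x \<noteq> 0"
  shows "1 / real (Suc n) \<le> x" "x \<le> 1 - 1 / real (Suc n)"
proof -
  have gt: "1 < real (Suc n) * (x * (1 - x))"
    using assms by (auto simp: cutoff_def flat_def split: if_splits)
  then have "0 < real (Suc n) * (x * (1 - x))" by linarith
  then have "0 < x * (1 - x)" by (simp add: zero_less_mult_iff)
  then have x: "0 < x" "x < 1" by (auto simp: zero_less_mult_iff)
  have "1 / real (Suc n) < x * (1 - x)" using gt by (simp add: field_simps del: of_nat_Suc)
  moreover have "x * (1 - x) \<le> x" "x * (1 - x) \<le> 1 - x"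
    using x mult_left_mono[of "1 - x" 1 x] mult_right_mono[of x 1 "1 - x"] by auto
  ultimately have "1 / real (Suc n) \<le> x" "1 / real (Suc n) \<le> 1 - x" by simp_all
  then show "1 / real (Suc n) \<le> x" "x \<le> 1 - 1 / real (Suc n)" by linarith+
qed

lemma flat_le: "0 \<le> flat m t" "m \<le> 2 \<Longrightarrow> flat m t \<le> 4" "0 < t \<Longrightarrow> flat m t \<le> (1 / t) ^ m"
proof -
  show "0 \<le> flat m t" by (simp add: flat_def)
  show "0 < t \<Longrightarrow> flat m t \<le> (1 / t) ^ m"
    unfolding flat_def by (simp add: mult_left_le_one_le)
  assume "m \<le> 2"
  show "flat m t \<le> 4"
  proof (cases "t > 0")
    case True
    define w where "w = 1 / t"
    have w: "0 < w" using True by (simp add: w_def)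
    \<comment> \<open>The bound \<open>4\<close> comes from squaring \<open>w / 2 \<le> exp (w / 2)\<close>.\<close>
    have "w / 2 \<le> exp (w / 2)" using exp_ge_add_one_self[of "w / 2"] by linarith
    then have "(w / 2)\<^sup>2 \<le> (exp (w / 2))\<^sup>2" using w by (intro power_mono) auto
    also have "(exp (w / 2))\<^sup>2 = exp w" by (simp add: power2_eq_square exp_add[symmetric])
    finally have "w ^ 2 \<le> 4 * exp w" by (simp add: power_divide)
    moreover have "w \<le> 4 * exp w" "1 \<le> 4 * exp w" using exp_ge_add_one_self[of w] w by linarith+
    moreover have "m = 0 \<or> m = 1 \<or> m = 2" using \<open>m \<le> 2\<close> by linarith
    ultimately have "w ^ m \<le> 4 * exp w" by auto
    then have "exp (- w) * w ^ m \<le> 4"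
      by (simp add: exp_minus field_simps)
    then show ?thesis using True by (simp add: flat_def w_def)
  qed (simp add: flat_def)
qed

lemma filterlim_cutoff_arg:
  assumes "0 < x" "x < 1"
  shows "filterlim (\<lambda>n. real (Suc n) * (x * (1 - x)) - 1) at_top sequentially"
proof -
  have "filterlim (\<lambda>n. -1 + (x * (1 - x)) * real (Suc n)) at_top sequentially"
    using assms
    by (intro filterlim_tendsto_add_at_top[OF tendsto_const] filterlim_tendsto_pos_mult_at_top[OF tendsto_const]
        filterlim_compose[OF filterlim_real_sequentially] filterlim_Suc) simp
  then show ?thesis by (simp add: algebra_simps)
qed

lemma flat_tendsto: "(flat 0 \<longlongrightarrow> 1) at_top" "0 < m \<Longrightarrow> (flat m \<longlongrightarrow> 0) at_top"
proof -
  have inv: "((\<lambda>t::real. 1 / t) \<longlongrightarrow> 0) at_top"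
    using tendsto_inverse_0_at_top[OF filterlim_ident] by (simp add: divide_inverse)
  have "((\<lambda>t::real. exp (- (1 / t))) \<longlongrightarrow> exp (- 0)) at_top"
    by (intro tendsto_intros inv)
  moreover have "\<forall>\<^sub>F t in at_top. exp (- (1 / t)) = flat 0 t"
    using eventually_gt_at_top[of 0] by eventually_elim (simp add: flat_def)
  ultimately show "(flat 0 \<longlongrightarrow> 1) at_top"
    using Lim_transform_eventually by fastforce
  assume "0 < m"
  show "(flat m \<longlongrightarrow> 0) at_top"
  proof (rule tendsto_sandwich[OF _ _ tendsto_const])
    show "\<forall>\<^sub>F t in at_top. flat m t \<le> (1 / t) ^ m"
      using eventually_gt_at_top[of 0] by eventually_elim (rule flat_le(3))
    show "((\<lambda>t::real. (1 / t) ^ m) \<longlongrightarrow> 0) at_top"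
      using tendsto_power[OF inv, of m] \<open>0 < m\<close> by (simp add: power_0_left)
  qed (simp add: flat_le)
qed

lemma cutoff_tendsto: "0 < x \<Longrightarrow> x < 1 \<Longrightarrow> (\<lambda>n. cutoff n x) \<longlonglongrightarrow> 1"
  unfolding cutoff_def by (rule filterlim_compose[OF flat_tendsto(1) filterlim_cutoff_arg])

text \<open>With \<open>t = (n + 1) x (1 - x) - 1\<close> the product of \<open>x (1 - x)\<close> with the derivative of the cutoff is, up to the
  factor \<open>1 - 2 x\<close>, equal to \<open>(t + 1) exp (- 1 / t) / t\<^sup>2\<close>: bounded, and null as \<open>t\<close> tends to infinity.\<close>

lemma cutoff_deriv_weighted:
  assumes "0 < x" "x < 1"
  defines "c n \<equiv> real (Suc n) * (1 - 2 * x) * flat 2 (real (Suc n) * (x * (1 - x)) - 1)"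
  shows "\<bar>c n\<bar> * (x * (1 - x)) \<le> 8" "(\<lambda>n. \<bar>c n\<bar> * (x * (1 - x))) \<longlonglongrightarrow> 0"
proof -
  define t where "t n = real (Suc n) * (x * (1 - x)) - 1" for n
  have le: "\<bar>c n\<bar> * (x * (1 - x)) \<le> flat 1 (t n) + flat 2 (t n)" for n
  proof -
    have "\<bar>c n\<bar> * (x * (1 - x)) = \<bar>1 - 2 * x\<bar> * ((t n + 1) * flat 2 (t n))"
      using flat_le(1)[of 2 "t n"] by (simp add: c_def t_def abs_mult)
    also have "(t n + 1) * flat 2 (t n) = flat 1 (t n) + flat 2 (t n)"
      by (simp add: flat_def field_simps power2_eq_square)
    also have "\<bar>1 - 2 * x\<bar> * (flat 1 (t n) + flat 2 (t n)) \<le> 1 * (flat 1 (t n) + flat 2 (t n))"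
      using assms flat_le(1)[of 1 "t n"] flat_le(1)[of 2 "t n"] by (intro mult_right_mono) auto
    finally show ?thesis by simp
  qed
  show "\<bar>c n\<bar> * (x * (1 - x)) \<le> 8"
    using le[of n] flat_le(2)[of 1 "t n"] flat_le(2)[of 2 "t n"] by linarith
  have lim: "(\<lambda>n. flat 1 (t n) + flat 2 (t n)) \<longlonglongrightarrow> 0 + 0"
    unfolding t_def by (intro tendsto_add filterlim_compose[OF flat_tendsto(2) filterlim_cutoff_arg] assms) auto
  show "(\<lambda>n. \<bar>c n\<bar> * (x * (1 - x))) \<longlonglongrightarrow> 0"
    by (rule tendsto_sandwich[OF _ _ tendsto_const lim[simplified]])
       (use assms le in \<open>auto intro!: always_eventually\<close>)
qed

text \<open>Test functions vanish near the boundary. Cutting off a function \<open>S\<close> that does not costs only a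
  term containing the normal derivative of the cutoff, which disappears in the limit if \<open>S\<close> is \<open>O(x (1 - x))\<close>
  and is absent for tangential derivatives.\<close>

lemma weak_gradient_by_parts:
  assumes G: "is_weak_gradient L \<zeta> G" and \<zeta>: "\<zeta> \<in> L2 (slab L)"
    and S: "smooth S" "torus_periodic L S" and b: "b \<in> Basis"
    and C: "fst b = 0 \<or> (\<forall>p\<in>space (slab L). \<bar>S p\<bar> \<le> C * (fst p * (1 - fst p)))"
  shows "(\<integral>p. \<zeta> p * partial_deriv b S p \<partial>slab L) = - (\<integral>p. (G p \<bullet> b) * S p \<partial>slab L)"
proof -
  define \<phi> where "\<phi> n p = cutoff n (fst p) * S p" for n :: nat and p :: point
  define c where "c n x = real (Suc n) * (1 - 2 * x) * flat 2 (real (Suc n) * (x * (1 - x)) - 1)" for n :: nat and x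
  have \<phi>_smooth: "smooth (\<phi> n)" for n
    unfolding \<phi>_def
    by (rule smooth_mult[OF smooth_compose[OF smooth_cutoff smooth_bounded_linear[OF bounded_linear_fst]] S(1)])
  have test: "\<phi> n \<in> test_functions L" for n
  proof -
    have "torus_periodic L (\<phi> n)" using S(2) by (simp add: torus_periodic_def \<phi>_def)
    moreover have "\<forall>p. \<phi> n p \<noteq> 0 \<longrightarrow> fst p \<in> {1 / real (Suc n)..1 - 1 / real (Suc n)}"
      using cutoff_support[of n] by (auto simp: \<phi>_def)
    moreover have "0 < 1 / real (Suc n)" "1 - 1 / real (Suc n) < 1" by simp_all
    ultimately show ?thesis using \<phi>_smooth unfolding test_functions_def by blast
  qed
  have \<phi>': "partial_deriv b (\<phi> n) p = cutoff n (fst p) * partial_deriv b S p + c n (fst p) * fst b * S p" for n p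
  proof -
    have "((\<lambda>p::point. cutoff n (fst p)) has_derivative (\<lambda>v. c n (fst p) * fst v)) (at p)"
      using has_derivative_compose[OF bounded_linear_imp_has_derivative[OF bounded_linear_fst]
          cutoff_deriv[of n "fst p", unfolded has_field_derivative_def]]
      by (simp add: c_def)
    from partial_deriv_eq[OF has_derivative_mult[OF this smooth_has_derivative[OF S(1)]]]
    show ?thesis by (simp add: \<phi>_def[abs_def] partial_deriv_def[of b S])
  qed
  have GL: "(\<lambda>p. G p \<bullet> b) \<in> L2 (slab L)"
    using G by (auto simp: is_weak_gradient_def intro: L2_component)
  have SL: "S \<in> L2 (slab L)" "partial_deriv b S \<in> L2 (slab L)" "\<phi> n \<in> L2 (slab L)"
    "partial_deriv b (\<phi> n) \<in> L2 (slab L)" for n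
    by (intro continuous_L2_slab smooth_continuous smooth_partial_deriv S \<phi>_smooth b)+
  have cut: "\<bar>cutoff n x\<bar> \<le> 4" for n x
    unfolding cutoff_def using flat_le(1,2)[of 0] by simp
  have normal: "\<bar>c n (fst p) * fst b * S p\<bar> \<le> \<bar>fst b\<bar> * \<bar>C\<bar> * (\<bar>c n (fst p)\<bar> * (fst p * (1 - fst p)))"
    if p: "p \<in> space (slab L)" for n p
  proof (cases "fst b = 0")
    case False
    have pos: "0 \<le> fst p * (1 - fst p)" using p by (auto simp: space_slab)
    have "\<bar>S p\<bar> \<le> C * (fst p * (1 - fst p))" using C False p by auto
    also have "\<dots> \<le> \<bar>C\<bar> * (fst p * (1 - fst p))" using pos by (intro mult_right_mono) auto
    finally have "\<bar>c n (fst p)\<bar> * \<bar>fst b\<bar> * \<bar>S p\<bar> \<le> \<bar>c n (fst p)\<bar> * \<bar>fst b\<bar> * (\<bar>C\<bar> * (fst p * (1 - fst p)))"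
      by (intro mult_left_mono) auto
    then show ?thesis by (simp add: abs_mult mult_ac)
  qed simp
  have "(\<lambda>n. \<integral>p. \<zeta> p * partial_deriv b (\<phi> n) p \<partial>slab L) \<longlonglongrightarrow> (\<integral>p. \<zeta> p * partial_deriv b S p \<partial>slab L)"
  proof (rule integral_dominated_convergence[where w = "\<lambda>p. 4 * \<bar>\<zeta> p * partial_deriv b S p\<bar> + \<bar>fst b\<bar> * \<bar>C\<bar> * 8 * \<bar>\<zeta> p\<bar>"])
    show "integrable (slab L) (\<lambda>p. 4 * \<bar>\<zeta> p * partial_deriv b S p\<bar> + \<bar>fst b\<bar> * \<bar>C\<bar> * 8 * \<bar>\<zeta> p\<bar>)"
      using L2_mult_integrable[OF \<zeta> SL(2)] L2_integrable[OF finite_slab \<zeta>] by simp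
    show "AE p in slab L. (\<lambda>n. \<zeta> p * partial_deriv b (\<phi> n) p) \<longlonglongrightarrow> \<zeta> p * partial_deriv b S p"
    proof (rule AE_I2)
      fix p assume p: "p \<in> space (slab L)"
      then have x: "0 < fst p" "fst p < 1" by (auto simp: space_slab)
      have "(\<lambda>n. \<bar>fst b\<bar> * \<bar>C\<bar> * (\<bar>c n (fst p)\<bar> * (fst p * (1 - fst p)))) \<longlonglongrightarrow> \<bar>fst b\<bar> * \<bar>C\<bar> * 0"
        unfolding c_def by (rule tendsto_mult[OF tendsto_const cutoff_deriv_weighted(2)[OF x]])
      then have "(\<lambda>n. c n (fst p) * fst b * S p) \<longlonglongrightarrow> 0"
        using normal[OF p]
        by (intro Lim_null_comparison[of "\<lambda>n. c n (fst p) * fst b * S p"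
              "\<lambda>n. \<bar>fst b\<bar> * \<bar>C\<bar> * (\<bar>c n (fst p)\<bar> * (fst p * (1 - fst p)))"] always_eventually) simp_all
      then have "(\<lambda>n. \<zeta> p * (cutoff n (fst p) * partial_deriv b S p + c n (fst p) * fst b * S p))
          \<longlonglongrightarrow> \<zeta> p * (1 * partial_deriv b S p + 0)"
        by (rule tendsto_mult[OF tendsto_const tendsto_add[OF tendsto_mult[OF cutoff_tendsto[OF x] tendsto_const]]])
      then show "(\<lambda>n. \<zeta> p * partial_deriv b (\<phi> n) p) \<longlonglongrightarrow> \<zeta> p * partial_deriv b S p"
        by (simp add: \<phi>')
    qed
    show "AE p in slab L. norm (\<zeta> p * partial_deriv b (\<phi> n) p)
        \<le> 4 * \<bar>\<zeta> p * partial_deriv b S p\<bar> + \<bar>fst b\<bar> * \<bar>C\<bar> * 8 * \<bar>\<zeta> p\<bar>" for n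
    proof (rule AE_I2)
      fix p assume p: "p \<in> space (slab L)"
      then have x: "0 < fst p" "fst p < 1" by (auto simp: space_slab)
      have "\<bar>c n (fst p) * fst b * S p\<bar> \<le> \<bar>fst b\<bar> * \<bar>C\<bar> * 8"
        using normal[OF p, of n] mult_left_mono[OF cutoff_deriv_weighted(1)[OF x, of n], of "\<bar>fst b\<bar> * \<bar>C\<bar>"]
        by (simp add: c_def)
      moreover have "\<bar>cutoff n (fst p) * partial_deriv b S p\<bar> \<le> 4 * \<bar>partial_deriv b S p\<bar>"
        unfolding abs_mult by (intro mult_right_mono cut) simp
      ultimately have "\<bar>partial_deriv b (\<phi> n) p\<bar> \<le> 4 * \<bar>partial_deriv b S p\<bar> + \<bar>fst b\<bar> * \<bar>C\<bar> * 8"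
        unfolding \<phi>' by (intro order_trans[OF abs_triangle_ineq] add_mono)
      then have "\<bar>\<zeta> p\<bar> * \<bar>partial_deriv b (\<phi> n) p\<bar> \<le> \<bar>\<zeta> p\<bar> * (4 * \<bar>partial_deriv b S p\<bar> + \<bar>fst b\<bar> * \<bar>C\<bar> * 8)"
        by (rule mult_left_mono) simp
      then show "norm (\<zeta> p * partial_deriv b (\<phi> n) p)
        \<le> 4 * \<bar>\<zeta> p * partial_deriv b S p\<bar> + \<bar>fst b\<bar> * \<bar>C\<bar> * 8 * \<bar>\<zeta> p\<bar>"
        by (simp add: abs_mult algebra_simps)
    qed
  qed (use L2_D(1)[OF \<zeta>] L2_D(1)[OF SL(2)] L2_D(1)[OF SL(4)] in auto)
  moreover have "(\<lambda>n. - (\<integral>p. (G p \<bullet> b) * \<phi> n p \<partial>slab L)) \<longlonglongrightarrow> - (\<integral>p. (G p \<bullet> b) * S p \<partial>slab L)"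
  proof (rule tendsto_minus, rule integral_dominated_convergence[where w = "\<lambda>p. 4 * \<bar>(G p \<bullet> b) * S p\<bar>"])
    show "integrable (slab L) (\<lambda>p. 4 * \<bar>(G p \<bullet> b) * S p\<bar>)"
      using L2_mult_integrable[OF GL SL(1)] by simp
    show "AE p in slab L. (\<lambda>n. (G p \<bullet> b) * \<phi> n p) \<longlonglongrightarrow> (G p \<bullet> b) * S p"
    proof (rule AE_I2)
      fix p assume "p \<in> space (slab L)"
      then have "(\<lambda>n. (G p \<bullet> b) * (cutoff n (fst p) * S p)) \<longlonglongrightarrow> (G p \<bullet> b) * (1 * S p)"
        by (intro tendsto_mult[OF tendsto_const tendsto_mult[OF cutoff_tendsto tendsto_const]]) (auto simp: space_slab)
      then show "(\<lambda>n. (G p \<bullet> b) * \<phi> n p) \<longlonglongrightarrow> (G p \<bullet> b) * S p" by (simp add: \<phi>_def)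
    qed
    show "AE p in slab L. norm ((G p \<bullet> b) * \<phi> n p) \<le> 4 * \<bar>(G p \<bullet> b) * S p\<bar>" for n
      using mult_right_mono[OF cut, of "\<bar>(G _ \<bullet> b) * S _\<bar>"]
      by (auto intro!: AE_I2 simp: \<phi>_def abs_mult mult_ac)
  qed (use L2_D(1)[OF GL] L2_D(1)[OF SL(1)] L2_D(1)[OF SL(3)] in auto)
  moreover have "(\<integral>p. \<zeta> p * partial_deriv b (\<phi> n) p \<partial>slab L) = - (\<integral>p. (G p \<bullet> b) * \<phi> n p \<partial>slab L)" for n
    using G test b unfolding is_weak_gradient_def by blast
  ultimately show ?thesis
    by (simp only:) (rule LIMSEQ_unique)
qed

section \<open>Approximation by smooth functions\<close>

text \<open>The finite set works for all larger ones, so that several expansions can later be truncated at the same indices.\<close>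

lemma orthogonal_expansion_approx:
  fixes f :: "'i \<Rightarrow> 'a \<Rightarrow> real"
  assumes f: "\<And>i. f i \<in> L2 M" and g: "g \<in> L2 M"
    and orth: "\<And>i j. i \<noteq> j \<Longrightarrow> (\<integral>x. f i x * f j x \<partial>M) = 0"
    and d: "\<And>i. (\<integral>x. g x * f i x \<partial>M) = d i * (\<integral>x. f i x * f i x \<partial>M)"
    and dense: "\<exists>p\<in>lincomb f. L2_norm M (\<lambda>x. g x - p x) < e"
  shows "\<exists>F\<^sub>0. finite F\<^sub>0 \<and> (\<forall>F. finite F \<longrightarrow> F\<^sub>0 \<subseteq> F \<longrightarrow>
    L2_norm M (\<lambda>x. g x - (\<Sum>i\<in>F. d i * f i x)) < e)"
proof -
  obtain p where p: "p \<in> lincomb f" "L2_norm M (\<lambda>x. g x - p x) < e" using dense by blast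
  obtain F\<^sub>0 a where F0: "finite F\<^sub>0" and p_eq: "p = (\<lambda>x. \<Sum>i\<in>F\<^sub>0. a i * f i x)"
    using lincomb_finite_sum[OF p(1)] by blast
  show ?thesis
  proof (intro exI[of _ F\<^sub>0] conjI F0 allI impI)
    fix F assume F: "finite F" "F\<^sub>0 \<subseteq> F"
    have "p = (\<lambda>x. \<Sum>i\<in>F. (if i \<in> F\<^sub>0 then a i else 0) * f i x)"
      unfolding p_eq using F by (intro ext sum.mono_neutral_cong_left) auto
    moreover have "L2_norm M (\<lambda>x. g x - (\<Sum>i\<in>F. d i * f i x))
        \<le> L2_norm M (\<lambda>x. g x - (\<Sum>i\<in>F. (if i \<in> F\<^sub>0 then a i else 0) * f i x))"
      by (rule orthogonal_best_approximation[OF F(1) f g orth d])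
    ultimately show "L2_norm M (\<lambda>x. g x - (\<Sum>i\<in>F. d i * f i x)) < e" using p(2) by simp
  qed
qed

lemma lincomb_reindex:
  assumes "f \<in> lincomb e" and "\<And>i. \<sigma> (\<sigma> i) = i"
  shows "f \<in> lincomb (\<lambda>i. e (\<sigma> i))"
  using assms(1)
proof induction
  case (base i)
  show ?case using lincomb.base[of "\<lambda>i. e (\<sigma> i)" "\<sigma> i"] assms(2) by simp
qed (auto intro: lincomb.intros)

lemma partial_deriv_sum:
  assumes "finite F" "\<And>i. i \<in> F \<Longrightarrow> smooth (f i)"
  shows "partial_deriv b (\<lambda>x. \<Sum>i\<in>F. c i * f i x) x = (\<Sum>i\<in>F. c i * partial_deriv b (f i) x)"
proof -
  have "((\<lambda>x. \<Sum>i\<in>F. c i * f i x) has_derivative (\<lambda>h. \<Sum>i\<in>F. c i * frechet_derivative (f i) (at x) h)) (at x)"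
    using assms(2) by (intro has_derivative_sum has_derivative_mult_right smooth_has_derivative)
  from partial_deriv_eq[OF this] show ?thesis by (simp add: partial_deriv_def)
qed

text \<open>The sine modes vanish on the boundary to first order, which is what makes them admissible against the
  normal derivative.\<close>

lemma sine_mode_bound:
  assumes p: "p \<in> space (slab L)"
  shows "\<bar>mode sine L i p\<bar> \<le> 8 * real (fst i) * pi * (fst p * (1 - fst p))"
proof -
  obtain x k where xk: "x = fst p" "k = fst i" by simp
  have x: "0 < x" "x < 1" using p by (auto simp: space_slab xk)
  have "\<bar>sine k x\<bar> \<le> real k * pi * x"
    using abs_sin_x_le_abs_x[of "real k * pi * x"] x by (simp add: sine_def abs_mult)
  moreover have "\<bar>sine k x\<bar> \<le> real k * pi * (1 - x)"
  proof -
    have "sin (real k * pi * (1 - x)) = - ((-1) ^ k) * sine k x"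
      by (simp add: right_diff_distrib sin_diff sine_def cos_npi sin_npi)
    then have "\<bar>sine k x\<bar> = \<bar>sin (real k * pi * (1 - x))\<bar>" by (simp add: abs_mult power_abs)
    also have "\<dots> \<le> real k * pi * (1 - x)"
      using abs_sin_x_le_abs_x[of "real k * pi * (1 - x)"] x by (simp add: abs_mult)
    finally show ?thesis .
  qed
  ultimately have "\<bar>sine k x\<bar> \<le> (real k * pi) * min x (1 - x)"
    by (simp add: min_def)
  also have "\<dots> \<le> (real k * pi) * (2 * (x * (1 - x)))"
  proof (rule mult_left_mono)
    show "min x (1 - x) \<le> 2 * (x * (1 - x))"
    proof (cases "x \<le> 1 / 2")
      case True
      then have "x * 1 \<le> x * (2 * (1 - x))" using x by (intro mult_left_mono) auto
      then show ?thesis by (simp add: min_def algebra_simps)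
    next
      case False
      then have "1 * (1 - x) \<le> (2 * x) * (1 - x)" using x by (intro mult_right_mono) auto
      then show ?thesis by (simp add: min_def algebra_simps)
    qed
  qed simp
  finally have s: "\<bar>sine k x\<bar> \<le> real k * pi * (2 * (x * (1 - x)))" .
  have cas: "\<bar>cas L m y\<bar> \<le> 2" for m y
    unfolding cas_def by (rule order_trans[OF abs_triangle_ineq]) (use abs_cos_le_one abs_sin_le_one in \<open>smt (verit)\<close>)
  have "\<bar>mode sine L i p\<bar> = \<bar>sine k x\<bar> * (\<bar>cas L (fst (snd i)) (fst (snd p))\<bar> * \<bar>cas L (snd (snd i)) (snd (snd p))\<bar>)"
    by (simp add: mode_def xk abs_mult)
  also have "\<dots> \<le> (real k * pi * (2 * (x * (1 - x)))) * (2 * 2)"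
    using s x by (intro mult_mono cas) auto
  finally show ?thesis by (simp add: xk mult_ac)
qed

lemma point_Basis: "(Basis :: point set) = {(1, 0), (0, 1, 0), (0, 0, 1)}"
  by (auto simp: Basis_prod_def)

text \<open>If \<open>u\<close> is a partial sum of the cosine expansion of \<open>\<zeta>\<close>, then each partial derivative of \<open>u\<close> is the partial sum
  over the same indices of an orthogonal expansion of the corresponding component of the weak gradient:
  integration by parts matches the coefficients. So one large index set serves all four approximations.\<close>

lemma smooth_approximation:
  assumes L: "0 < L" and \<zeta>: "\<zeta> \<in> L2 (slab L)" and G: "is_weak_gradient L \<zeta> G" and e: "0 < e"
  shows "\<exists>u. smooth u \<and> torus_periodic L u \<and> L2_norm (slab L) (\<lambda>p. u p - \<zeta> p) < e
    \<and> (\<forall>b\<in>Basis. L2_norm (slab L) (\<lambda>p. partial_deriv b u p - G p \<bullet> b) < e)"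
proof -
  let ?C = "mode cosine L" and ?S = "mode sine L"
  define c where "c i = (\<integral>p. \<zeta> p * ?C i p \<partial>slab L) / (\<integral>p. ?C i p * ?C i p \<partial>slab L)" for i
  have CL: "?C i \<in> L2 (slab L)" and SL: "?S i \<in> L2 (slab L)" for i
    by (intro continuous_L2_slab continuous_mode continuous_cosine continuous_sine)+
  have GL: "(\<lambda>p. G p \<bullet> b) \<in> L2 (slab L)" for b
    using G by (auto simp: is_weak_gradient_def intro: L2_component)
  have N: "(\<integral>p. ?C i p * ?C i p \<partial>slab L) \<noteq> 0" for i
    using L by (simp add: mode_norm)
  have c: "(\<integral>p. \<zeta> p * ?C i p \<partial>slab L) = c i * (\<integral>p. ?C i p * ?C i p \<partial>slab L)" for i
    using N by (simp add: c_def)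
  note smooth_modes = smooth_mode[of cosine, OF smooth_cosine] smooth_mode[of sine, OF smooth_sine]
  have parts: "(\<integral>p. (G p \<bullet> b) * S p \<partial>slab L) = - (\<integral>p. \<zeta> p * partial_deriv b S p \<partial>slab L)"
    if "smooth S" "torus_periodic L S" "b \<in> Basis"
      "fst b = 0 \<or> (\<forall>p\<in>space (slab L). \<bar>S p\<bar> \<le> K * (fst p * (1 - fst p)))" for S b K
    using weak_gradient_by_parts[OF G \<zeta> that] by simp
  have pull: "(\<integral>p. \<zeta> p * (a * f p) \<partial>slab L) = a * (\<integral>p. \<zeta> p * f p \<partial>slab L)" for a :: real and f
    unfolding mult.left_commute[of "\<zeta> _" a] by (rule integral_mult_right_zero)
  obtain F0 where F0: "finite F0"
    "\<forall>F. finite F \<longrightarrow> F0 \<subseteq> F \<longrightarrow> L2_norm (slab L) (\<lambda>p. \<zeta> p - (\<Sum>i\<in>F. c i * ?C i p)) < e"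
    using orthogonal_expansion_approx[OF CL \<zeta> mode_orthogonal(1)[OF L] c cosine_modes_dense[OF L \<zeta> e]] by blast
  define d1 where "d1 i = - (real (fst i) * pi) * c i" for i :: "nat \<times> int \<times> int"
  have d1: "(\<integral>p. (G p \<bullet> (1, 0)) * ?S i p \<partial>slab L) = d1 i * (\<integral>p. ?S i p * ?S i p \<partial>slab L)" for i
  proof -
    have "(\<integral>p. (G p \<bullet> (1, 0)) * ?S i p \<partial>slab L) = - (\<integral>p. \<zeta> p * partial_deriv (1, 0) (?S i) p \<partial>slab L)"
      by (rule parts[OF smooth_modes(2) torus_periodic_mode[OF L] e1_Basis])
         (use sine_mode_bound in blast)
    also have "\<dots> = - (real (fst i) * pi) * (\<integral>p. \<zeta> p * ?C i p \<partial>slab L)"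
      unfolding partial_deriv_mode_normal pull by simp
    finally show ?thesis using c[of i] L by (simp add: d1_def mode_norm)
  qed
  obtain F1 where F1: "finite F1"
    "\<forall>F. finite F \<longrightarrow> F1 \<subseteq> F \<longrightarrow> L2_norm (slab L) (\<lambda>p. G p \<bullet> (1, 0) - (\<Sum>i\<in>F. d1 i * ?S i p)) < e"
    using orthogonal_expansion_approx[OF SL GL mode_orthogonal(2)[OF L] d1 sine_modes_dense[OF L GL e]] by blast
  \<comment> \<open>A tangential derivative of the mode \<open>i\<close> is a multiple of the mode with one frequency negated, so the components of \<open>G\<close> in
    these directions are expanded in the family reindexed by that involution.\<close>
  define flip2 flip3 :: "nat \<times> int \<times> int \<Rightarrow> nat \<times> int \<times> int"
    where "flip2 = (\<lambda>(k, m, n). (k, - m, n))" and "flip3 = (\<lambda>(k, m, n). (k, m, - n))"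
  have flip: "flip2 (flip2 i) = i" "flip3 (flip3 i) = i" "fst (flip2 i) = fst i" "fst (flip3 i) = fst i" for i
    by (simp_all add: flip2_def flip3_def split: prod.splits)
  have tangential: "\<exists>F0. finite F0 \<and> (\<forall>F. finite F \<longrightarrow> F0 \<subseteq> F \<longrightarrow>
      L2_norm (slab L) (\<lambda>p. G p \<bullet> b - (\<Sum>i\<in>F. (w i * c i) * ?C (\<sigma> i) p)) < e)"
    if \<sigma>: "\<And>i. \<sigma> (\<sigma> i) = i" "\<And>i. fst (\<sigma> i) = fst i" and b: "b \<in> Basis" "fst b = 0"
      and w: "\<And>i p. partial_deriv b (?C (\<sigma> i)) p = - w i * ?C i p" for b w \<sigma>
  proof -
    have o: "(\<integral>p. ?C (\<sigma> i) p * ?C (\<sigma> j) p \<partial>slab L) = 0" if "i \<noteq> j" for i j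
      using that \<sigma>(1) by (intro mode_orthogonal(1)[OF L]) metis
    have d: "(\<integral>p. (G p \<bullet> b) * ?C (\<sigma> i) p \<partial>slab L) = (w i * c i) * (\<integral>p. ?C (\<sigma> i) p * ?C (\<sigma> i) p \<partial>slab L)" for i
    proof -
      have "(\<integral>p. (G p \<bullet> b) * ?C (\<sigma> i) p \<partial>slab L) = - (\<integral>p. \<zeta> p * partial_deriv b (?C (\<sigma> i)) p \<partial>slab L)"
        by (rule parts[OF smooth_modes(1) torus_periodic_mode[OF L] b(1)]) (simp add: b(2))
      also have "\<dots> = w i * (\<integral>p. \<zeta> p * ?C i p \<partial>slab L)"
        unfolding w pull by simp
      finally show ?thesis using c[of i] L \<sigma>(2)[of i] by (simp add: mode_norm)
    qed
    have dense: "\<exists>p\<in>lincomb (\<lambda>i. ?C (\<sigma> i)). L2_norm (slab L) (\<lambda>x. G x \<bullet> b - p x) < e"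
      using cosine_modes_dense[OF L GL e] lincomb_reindex[OF _ \<sigma>(1)] by blast
    show ?thesis
      by (rule orthogonal_expansion_approx[OF CL GL o d dense])
  qed
  define w2 w3 where "w2 i = 2 * pi * of_int (fst (snd i)) / L" and "w3 i = 2 * pi * of_int (snd (snd i)) / L"
    for i :: "nat \<times> int \<times> int"
  have w2: "partial_deriv (0, 1, 0) (?C (flip2 i)) p = - w2 i * ?C i p"
    and w3: "partial_deriv (0, 0, 1) (?C (flip3 i)) p = - w3 i * ?C i p"
    and w2': "partial_deriv (0, 1, 0) (?C i) p = w2 i * ?C (flip2 i) p"
    and w3': "partial_deriv (0, 0, 1) (?C i) p = w3 i * ?C (flip3 i) p" for i p
    by (cases i; simp add: flip2_def flip3_def w2_def w3_def partial_deriv_mode_tangential)+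
  obtain F2 where F2: "finite F2" "\<forall>F. finite F \<longrightarrow> F2 \<subseteq> F \<longrightarrow>
      L2_norm (slab L) (\<lambda>p. G p \<bullet> (0, 1, 0) - (\<Sum>i\<in>F. (w2 i * c i) * ?C (flip2 i) p)) < e"
    using tangential[of flip2 "(0, 1, 0)" w2] flip w2 by (auto simp: point_Basis)
  obtain F3 where F3: "finite F3" "\<forall>F. finite F \<longrightarrow> F3 \<subseteq> F \<longrightarrow>
      L2_norm (slab L) (\<lambda>p. G p \<bullet> (0, 0, 1) - (\<Sum>i\<in>F. (w3 i * c i) * ?C (flip3 i) p)) < e"
    using tangential[of flip3 "(0, 0, 1)" w3] flip w3 by (auto simp: point_Basis)
  define F where "F = F0 \<union> F1 \<union> F2 \<union> F3"
  have F: "finite F" "F0 \<subseteq> F" "F1 \<subseteq> F" "F2 \<subseteq> F" "F3 \<subseteq> F"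
    using F0 F1 F2 F3 by (auto simp: F_def)
  define u where "u p = (\<Sum>i\<in>F. c i * ?C i p)" for p
  have u': "partial_deriv b u p = (\<Sum>i\<in>F. c i * partial_deriv b (?C i) p)" for b p
    unfolding u_def[abs_def] by (rule partial_deriv_sum[OF F(1) smooth_modes(1)])
  have "smooth u"
    unfolding u_def[abs_def] by (rule smooth_sum[OF smooth_mult[OF smooth_const smooth_modes(1)]])
  moreover have "torus_periodic L u"
    using torus_periodic_mode[OF L, of cosine] by (simp add: torus_periodic_def u_def)
  moreover have "L2_norm (slab L) (\<lambda>p. u p - \<zeta> p) < e"
    unfolding L2_norm_minus[of _ u \<zeta>] using F0(2)[rule_format, OF F(1,2)] by (simp add: u_def)
  moreover have "L2_norm (slab L) (\<lambda>p. partial_deriv b u p - G p \<bullet> b) < e" if "b \<in> Basis" for b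
  proof -
    have eqs: "partial_deriv (1, 0) u p = (\<Sum>i\<in>F. d1 i * ?S i p)"
      "partial_deriv (0, 1, 0) u p = (\<Sum>i\<in>F. (w2 i * c i) * ?C (flip2 i) p)"
      "partial_deriv (0, 0, 1) u p = (\<Sum>i\<in>F. (w3 i * c i) * ?C (flip3 i) p)" for p
      unfolding u' by (auto intro!: sum.cong simp: partial_deriv_mode_normal d1_def w2' w3' mult_ac)
    show ?thesis
      unfolding L2_norm_minus[of _ "partial_deriv b u"]
      using that F1(2)[rule_format, OF F(1,3)] F2(2)[rule_format, OF F(1,4)] F3(2)[rule_format, OF F(1,5)]
      by (auto simp: point_Basis eqs)
  qed
  ultimately show ?thesis by blast
qed

section \<open>Existence of traces\<close>

lemma jensen_square:
  fixes f :: "'a \<Rightarrow> real"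
  assumes M: "finite_measure M" "measure M (space M) = 1" and f: "f \<in> L2 M"
  shows "(\<integral>x. f x \<partial>M)\<^sup>2 \<le> (\<integral>x. (norm (f x))\<^sup>2 \<partial>M)"
proof -
  interpret finite_measure M by fact
  define c where "c = (\<integral>x. f x \<partial>M)"
  have i: "integrable M f" "integrable M (\<lambda>x. (f x)\<^sup>2)"
    using L2_integrable[OF M(1) f] L2_D(2)[OF f] by simp_all
  have "0 \<le> (\<integral>x. (f x - c)\<^sup>2 \<partial>M)" by simp
  also have "(\<lambda>x. (f x - c)\<^sup>2) = (\<lambda>x. (f x)\<^sup>2 - 2 * c * f x + c\<^sup>2)"
    by (simp add: power2_eq_square algebra_simps)
  also have "(\<integral>x. (f x)\<^sup>2 - 2 * c * f x + c\<^sup>2 \<partial>M) = (\<integral>x. (f x)\<^sup>2 \<partial>M) - 2 * c * c + c\<^sup>2"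
    using i M(2) by (simp add: c_def)
  finally show ?thesis by (simp add: c_def power2_eq_square)
qed

text \<open>Averaging over the unit interval contracts \<open>L\<^sup>2\<close>, by Jensen's inequality on almost every normal line.\<close>

lemma L2_normal_average:
  fixes h :: "point \<Rightarrow> real"
  assumes h: "h \<in> L2 (slab L)"
  shows "(\<lambda>w. \<integral>s. h (s, w) \<partial>unit_line) \<in> L2 (torus L)"
    and "L2_norm (torus L) (\<lambda>w. \<integral>s. h (s, w) \<partial>unit_line) \<le> L2_norm (slab L) h"
proof -
  let ?H = "\<lambda>w. \<integral>s. h (s, w) \<partial>unit_line"
  interpret pair_sigma_finite unit_line "torus L" by (rule pair_sigma_finite_slab)
  have i: "integrable (unit_line \<Otimes>\<^sub>M torus L) (\<lambda>(s, w). h (s, w))"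
    using L2_integrable[OF finite_slab h] by (simp add: slab_eq)
  have i2: "integrable (unit_line \<Otimes>\<^sub>M torus L) (\<lambda>(s, w). (norm (h (s, w)))\<^sup>2)"
    using L2_D(2)[OF h] by (simp add: slab_eq case_prod_unfold)
  have Hm: "?H \<in> borel_measurable (torus L)"
    using integrable_snd[OF i] by (rule borel_measurable_integrable)
  have le: "AE w in torus L. (?H w)\<^sup>2 \<le> (\<integral>s. (norm (h (s, w)))\<^sup>2 \<partial>unit_line)"
    using AE_integrable_snd[OF i] AE_integrable_snd[OF i2]
  proof eventually_elim
    case (elim w)
    then have "(\<lambda>s. h (s, w)) \<in> L2 unit_line" by (simp add: L2_def borel_measurable_integrable)
    from jensen_square[OF finite_unit_line measure_unit_line this] show ?case .
  qed
  have int: "integrable (torus L) (\<lambda>w. (?H w)\<^sup>2)"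
    by (rule Bochner_Integration.integrable_bound[OF integrable_snd[OF i2]])
       (use Hm le in \<open>auto elim!: eventually_mono\<close>)
  then show "?H \<in> L2 (torus L)" using Hm by (simp add: L2_def)
  have "(\<integral>w. (?H w)\<^sup>2 \<partial>torus L) \<le> (\<integral>w. (\<integral>s. (norm (h (s, w)))\<^sup>2 \<partial>unit_line) \<partial>torus L)"
    by (rule integral_mono_AE[OF int integrable_snd[OF i2] le])
  also have "\<dots> = (\<integral>p. (norm (h p))\<^sup>2 \<partial>slab L)"
    using integral_snd[OF i2] by (simp add: slab_eq case_prod_unfold)
  finally show "L2_norm (torus L) ?H \<le> L2_norm (slab L) h"
    by (simp add: L2_norm_def)
qed

text \<open>For smooth \<open>u\<close> and \<open>x \<in> {0, 1}\<close> the fundamental theorem of calculus gives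
  \<open>u (x, w) = \<integral> u (s, w) + (s + x - 1) u\<^sub>s (s, w) ds\<close>. The right-hand side makes sense for a weakly
  differentiable function and its weak normal derivative \<open>g\<close>.\<close>

definition boundary_value :: "(point \<Rightarrow> real) \<Rightarrow> (point \<Rightarrow> real) \<Rightarrow> point \<Rightarrow> real" where
  "boundary_value f g p = (\<integral>s. f (s, snd p) + (s + fst p - 1) * g (s, snd p) \<partial>unit_line)"

lemma boundary_value_smooth:
  assumes u: "smooth u" and x: "x \<in> {0, 1}"
  shows "boundary_value u (partial_deriv (1, 0) u) (x, w) = u (x, w)"
proof -
  let ?d = "partial_deriv (1, 0) u"
  have "((\<lambda>s. (s + x - 1) * u (s, w)) has_real_derivative u (s, w) + (s + x - 1) * ?d (s, w)) (at s)" for s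
    using smooth_slice_derivative[OF u, of w s] by (auto intro!: derivative_eq_intros)
  moreover have "continuous_on UNIV (\<lambda>s. u (s, w) + (s + x - 1) * ?d (s, w))"
    by (intro continuous_on_add continuous_on_mult continuous_on_diff continuous_on_id continuous_on_const
        continuous_slice(2) smooth_continuous smooth_partial_deriv u e1_Basis)
  ultimately have "boundary_value u ?d (x, w) = (1 + x - 1) * u (1, w) - (0 + x - 1) * u (0, w)"
    unfolding boundary_value_def fst_conv snd_conv by (rule integral_unit_line_FTC)
  then show ?thesis using x by auto
qed

lemma L2_weighted:
  assumes f: "f \<in> L2 (slab L)" and g: "g \<in> L2 (slab L)" and x: "x \<in> {0, 1}"
  shows "(\<lambda>p. f p + (fst p + x - 1) * g p) \<in> L2 (slab L)"
    and "L2_norm (slab L) (\<lambda>p. f p + (fst p + x - 1) * g p) \<le> L2_norm (slab L) f + L2_norm (slab L) g"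
proof -
  have "continuous_on UNIV (\<lambda>p::point. fst p + x - 1)"
    by (intro continuous_on_add continuous_on_diff continuous_on_fst continuous_on_id continuous_on_const)
  note [measurable] = L2_D(1)[OF g] L2_D(1)[OF continuous_L2_slab[OF this, of L]]
  have le: "AE p in slab L. norm ((fst p + x - 1) * g p) \<le> norm (g p)"
  proof (rule AE_I2)
    fix p assume "p \<in> space (slab L)"
    then have "\<bar>fst p + x - 1\<bar> \<le> 1" using x by (auto simp: space_slab)
    then show "norm ((fst p + x - 1) * g p) \<le> norm (g p)"
      by (simp add: abs_mult mult_left_le_one_le)
  qed
  have wg: "(\<lambda>p. (fst p + x - 1) * g p) \<in> L2 (slab L)"
    by (rule L2_dominated[OF g, of _ 1]) (use le in auto)
  show "(\<lambda>p. f p + (fst p + x - 1) * g p) \<in> L2 (slab L)" by (rule L2_add[OF f wg])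
  show "L2_norm (slab L) (\<lambda>p. f p + (fst p + x - 1) * g p) \<le> L2_norm (slab L) f + L2_norm (slab L) g"
    using L2_triangle[OF f wg] L2_norm_mono[OF wg g le] by linarith
qed

lemma L2_boundary_value:
  assumes f: "f \<in> L2 (slab L)" and g: "g \<in> L2 (slab L)" and x: "x \<in> {0, 1}"
  shows "(\<lambda>w. boundary_value f g (x, w)) \<in> L2 (torus L)"
    and "L2_norm (torus L) (\<lambda>w. boundary_value f g (x, w)) \<le> L2_norm (slab L) f + L2_norm (slab L) g"
  using L2_normal_average[OF L2_weighted(1)[OF assms]] L2_weighted(2)[OF assms]
  by (simp_all add: boundary_value_def)

lemma boundary_value_diff:
  assumes f: "f \<in> L2 (slab L)" "f' \<in> L2 (slab L)" and g: "g \<in> L2 (slab L)" "g' \<in> L2 (slab L)"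
    and x: "x \<in> {0, 1}"
  shows "AE w in torus L. boundary_value f g (x, w) - boundary_value f' g' (x, w)
    = boundary_value (\<lambda>p. f p - f' p) (\<lambda>p. g p - g' p) (x, w)"
proof -
  interpret pair_sigma_finite unit_line "torus L" by (rule pair_sigma_finite_slab)
  have "AE w in torus L. integrable unit_line (\<lambda>s. f (s, w) + (s + x - 1) * g (s, w))"
    if "f \<in> L2 (slab L)" "g \<in> L2 (slab L)" for f g
  proof -
    have "integrable (unit_line \<Otimes>\<^sub>M torus L) (\<lambda>(s, w). f (s, w) + (s + x - 1) * g (s, w))"
      using L2_integrable[OF finite_slab L2_weighted(1)[OF that x]] by (simp add: slab_eq case_prod_unfold)
    from AE_integrable_snd[OF this] show ?thesis .
  qed
  from this[OF f(1) g(1)] this[OF f(2) g(2)] show ?thesis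
  proof eventually_elim
    case (elim w)
    from Bochner_Integration.integral_diff[OF elim] show ?case
      by (simp add: boundary_value_def algebra_simps)
  qed
qed

text \<open>The difference of \<open>u\<close> and \<^term>\<open>boundary_value f g\<close> on the boundary is almost everywhere the boundary value of the
  differences, hence small; each of the two components of the boundary contributes at most \<open>2 * e\<close>.\<close>

lemma boundary_value_approx:
  assumes u: "smooth u" and f: "f \<in> L2 (slab L)" and g: "g \<in> L2 (slab L)"
    and e: "L2_norm (slab L) (\<lambda>p. u p - f p) < e" "L2_norm (slab L) (\<lambda>p. partial_deriv (1, 0) u p - g p) < e"
  shows "L2_norm (slab_boundary L) (\<lambda>p. u p - boundary_value f g p) \<le> 4 * e"
proof -
  let ?d = "partial_deriv (1, 0) u"
  have e0: "0 \<le> e" using e(1) L2_norm_nonneg[of "slab L" "\<lambda>p. u p - f p"] by linarith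
  have ud: "u \<in> L2 (slab L)" "?d \<in> L2 (slab L)"
    by (intro continuous_L2_slab smooth_continuous smooth_partial_deriv u e1_Basis)+
  have uT: "(\<lambda>w. u (x, w)) \<in> L2 (torus L)" for x
    by (intro continuous_L2_torus continuous_slice smooth_continuous u)
  have diff: "(\<lambda>w. u (x, w) - boundary_value f g (x, w)) \<in> L2 (torus L)" if "x \<in> {0, 1}" for x
    by (rule L2_diff[OF uT L2_boundary_value(1)[OF f g that]])
  have le: "(L2_norm (torus L) (\<lambda>w. u (x, w) - boundary_value f g (x, w)))\<^sup>2 \<le> (2 * e)\<^sup>2" if x: "x \<in> {0, 1}" for x
  proof (rule power_mono[OF _ L2_norm_nonneg])
    let ?b = "\<lambda>w. boundary_value (\<lambda>p. u p - f p) (\<lambda>p. ?d p - g p) (x, w)"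
    have "L2_norm (torus L) (\<lambda>w. u (x, w) - boundary_value f g (x, w)) \<le> L2_norm (torus L) ?b"
      using boundary_value_diff[OF ud(1) f ud(2) g x]
      by (intro L2_norm_mono[OF diff[OF x] L2_boundary_value(1)[OF L2_diff[OF ud(1) f] L2_diff[OF ud(2) g] x]])
         (auto elim!: eventually_mono simp: boundary_value_smooth[OF u x])
    also have "\<dots> \<le> L2_norm (slab L) (\<lambda>p. u p - f p) + L2_norm (slab L) (\<lambda>p. ?d p - g p)"
      by (rule L2_boundary_value(2)[OF L2_diff[OF ud(1) f] L2_diff[OF ud(2) g] x])
    finally show "L2_norm (torus L) (\<lambda>w. u (x, w) - boundary_value f g (x, w)) \<le> 2 * e"
      using e by linarith
  qed
  have "(L2_norm (slab_boundary L) (\<lambda>p. u p - boundary_value f g p))\<^sup>2 \<le> (2 * e)\<^sup>2 + (2 * e)\<^sup>2"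
    using L2_boundary(2)[OF diff] le[of 0] le[of 1] by simp
  also have "\<dots> \<le> (4 * e)\<^sup>2" by (simp add: power2_eq_square)
  finally show ?thesis by (rule power2_le_imp_le) (use e0 in simp)
qed

lemma gradient_inner:
  fixes f :: "'a::euclidean_space \<Rightarrow> real"
  shows "b \<in> Basis \<Longrightarrow> gradient f x \<bullet> b = partial_deriv b f x"
  unfolding gradient_def by simp

lemma L2_gradient:
  fixes u :: "point \<Rightarrow> real"
  assumes "smooth u"
  shows "gradient u \<in> L2 (slab L)"
proof -
  have "continuous_on UNIV (gradient u)"
    unfolding gradient_def[abs_def]
    by (intro continuous_on_sum continuous_on_scaleR continuous_on_const smooth_continuous smooth_partial_deriv assms)
  then show ?thesis by (rule continuous_L2_slab)
qed

lemma gradient_approx: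
  fixes u :: "point \<Rightarrow> real"
  assumes u: "smooth u" and G: "G \<in> L2 (slab L)"
    and e: "\<And>b. b \<in> Basis \<Longrightarrow> L2_norm (slab L) (\<lambda>p. partial_deriv b u p - G p \<bullet> b) < e"
  shows "L2_norm (slab L) (\<lambda>p. gradient u p - G p) \<le> 2 * e"
proof -
  have "0 \<le> e" using e[OF e1_Basis] L2_norm_nonneg[of "slab L" "\<lambda>p. partial_deriv (1, 0) u p - G p \<bullet> (1, 0)"] by linarith
  have "(L2_norm (slab L) (\<lambda>p. gradient u p - G p))\<^sup>2
      = (\<Sum>b\<in>Basis. (L2_norm (slab L) (\<lambda>p. partial_deriv b u p - G p \<bullet> b))\<^sup>2)"
    unfolding L2_norm_sq_components[OF L2_diff[OF L2_gradient[OF u] G]]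
    by (rule sum.cong) (simp_all add: inner_diff_left gradient_inner)
  also have "\<dots> \<le> (\<Sum>b\<in>(Basis :: point set). e\<^sup>2)"
    by (intro sum_mono power_mono L2_norm_nonneg less_imp_le e)
  also have "\<dots> \<le> (2 * e)\<^sup>2" by (simp add: power_mult_distrib)
  finally show ?thesis by (rule power2_le_imp_le) (use \<open>0 \<le> e\<close> in simp)
qed

lemma weak_gradient_H1:
  assumes "\<zeta> \<in> H1 L"
  shows "is_weak_gradient L \<zeta> (weak_gradient L \<zeta>)"
proof -
  obtain G where "is_weak_gradient L \<zeta> G" using assms by (auto simp: H1_def)
  then show ?thesis unfolding weak_gradient_def by (rule someI[of "is_weak_gradient L \<zeta>"])
qed

text \<open>The approximations of \<open>\<zeta>\<close> converge in \<^const>\<open>H1\<close> to \<open>\<zeta>\<close> and on the boundary to its boundary value, which is therefore a trace.\<close>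

lemma trace_exists:
  assumes L: "0 < L" and \<zeta>: "\<zeta> \<in> H1 L"
  shows "is_trace L \<zeta> (boundary_trace L \<zeta>)"
proof -
  define G where "G = weak_gradient L \<zeta>"
  have G: "is_weak_gradient L \<zeta> G" unfolding G_def by (rule weak_gradient_H1[OF \<zeta>])
  have GL: "G \<in> L2 (slab L)" and Gp: "torus_periodic L G" using G by (auto simp: is_weak_gradient_def)
  have \<zeta>L: "\<zeta> \<in> L2 (slab L)" and \<zeta>p: "torus_periodic L \<zeta>" using \<zeta> by (auto simp: H1_def)
  define \<tau> where "\<tau> = boundary_value \<zeta> (\<lambda>p. G p \<bullet> (1, 0))"
  define r where "r n = 1 / real (Suc n)" for n
  have r: "0 < r n" for n by (simp add: r_def)
  have "\<forall>n. \<exists>u. smooth u \<and> torus_periodic L u \<and> L2_norm (slab L) (\<lambda>p. u p - \<zeta> p) < r n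
      \<and> (\<forall>b\<in>Basis. L2_norm (slab L) (\<lambda>p. partial_deriv b u p - G p \<bullet> b) < r n)"
    by (rule allI, rule smooth_approximation[OF L \<zeta>L G r])
  from choice[OF this] obtain u where
    "\<forall>n. smooth (u n) \<and> torus_periodic L (u n) \<and> L2_norm (slab L) (\<lambda>p. u n p - \<zeta> p) < r n
      \<and> (\<forall>b\<in>Basis. L2_norm (slab L) (\<lambda>p. partial_deriv b (u n) p - G p \<bullet> b) < r n)" ..
  then have u: "smooth (u n)" "torus_periodic L (u n)"
    "L2_norm (slab L) (\<lambda>p. u n p - \<zeta> p) < r n"
    "b \<in> Basis \<Longrightarrow> L2_norm (slab L) (\<lambda>p. partial_deriv b (u n) p - G p \<bullet> b) < r n" for n b
    by blast+
  have lim: "(\<lambda>n. c * r n) \<longlonglongrightarrow> 0" for c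
    using tendsto_mult[OF tendsto_const[of c] LIMSEQ_inverse_real_of_nat] by (simp add: r_def divide_inverse)
  have null: "f \<longlonglongrightarrow> 0" if "\<And>n. 0 \<le> f n" "\<And>n. f n \<le> c * r n" for f c
    by (rule tendsto_sandwich[OF _ _ tendsto_const lim[of c]]) (use that in auto)
  have "(\<lambda>n. L2_norm (slab L) (\<lambda>x. u n x - \<zeta> x)) \<longlonglongrightarrow> 0"
    by (rule null[of _ 1]) (use u(3) L2_norm_nonneg in \<open>auto intro: less_imp_le\<close>)
  moreover have "(\<lambda>n. L2_norm (slab L) (\<lambda>x. gradient (u n) x - G x)) \<longlonglongrightarrow> 0"
    by (rule null[OF L2_norm_nonneg gradient_approx[OF u(1) GL u(4)]])
  moreover have "(\<lambda>n. L2_norm (slab_boundary L) (\<lambda>x. u n x - \<tau> x)) \<longlonglongrightarrow> 0"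
    unfolding \<tau>_def
    by (rule null[OF L2_norm_nonneg boundary_value_approx[OF u(1) \<zeta>L L2_component[OF GL] u(3) u(4)[OF e1_Basis]]])
  moreover have "torus_periodic L \<tau>"
    using \<zeta>p Gp by (simp add: torus_periodic_def \<tau>_def boundary_value_def)
  moreover have "\<tau> \<in> L2 (slab_boundary L)"
    unfolding \<tau>_def by (rule L2_boundary(1)[OF L2_boundary_value(1)[OF \<zeta>L L2_component[OF GL]]])
  ultimately have "is_trace L \<zeta> \<tau>"
    using u(1,2) unfolding is_trace_def G_def by blast
  then show ?thesis unfolding boundary_trace_def by (rule someI[of "is_trace L \<zeta>"])
qed

section \<open>The inequality\<close>

theorem lemma6p3:
  fixes L :: real and \<zeta> :: "real \<times> real \<times> real \<Rightarrow> real"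
  assumes "L > 0" and "\<zeta> \<in> H1 L"
  shows "(L2_norm (slab L) \<zeta>)\<^sup>2
           \<le> (L2_norm (slab L) (weak_gradient L \<zeta>))\<^sup>2
             + (L2_norm (slab_boundary L) (boundary_trace L \<zeta>))\<^sup>2"
proof -
  let ?G = "weak_gradient L \<zeta>" and ?\<tau> = "boundary_trace L \<zeta>"
  have L2s: "\<zeta> \<in> L2 (slab L)" "?G \<in> L2 (slab L)" "?\<tau> \<in> L2 (slab_boundary L)"
    using weak_gradient_H1[OF assms(2)] trace_exists[OF assms] assms(2)
    by (auto simp: H1_def is_weak_gradient_def is_trace_def)
  obtain u where u: "\<And>n. smooth (u n)"
    and lim: "(\<lambda>n. L2_norm (slab L) (\<lambda>x. u n x - \<zeta> x)) \<longlonglongrightarrow> 0"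
      "(\<lambda>n. L2_norm (slab L) (\<lambda>x. gradient (u n) x - ?G x)) \<longlonglongrightarrow> 0"
      "(\<lambda>n. L2_norm (slab_boundary L) (\<lambda>x. u n x - ?\<tau> x)) \<longlonglongrightarrow> 0"
    using trace_exists[OF assms] unfolding is_trace_def by blast
  have uL: "u n \<in> L2 (slab L)" "u n \<in> L2 (slab_boundary L)" for n
    by (intro continuous_L2_slab continuous_L2_boundary smooth_continuous u)+
  have le: "(L2_norm (slab L) (u n))\<^sup>2
      \<le> (L2_norm (slab L) (gradient (u n)))\<^sup>2 + (L2_norm (slab_boundary L) (u n))\<^sup>2" for n
  proof -
    have dL: "partial_deriv (1, 0) (u n) \<in> L2 (slab L)"
      by (intro continuous_L2_slab smooth_continuous smooth_partial_deriv u e1_Basis)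
    have "L2_norm (slab L) (partial_deriv (1, 0) (u n)) \<le> L2_norm (slab L) (gradient (u n))"
    proof (rule L2_norm_mono[OF dL L2_gradient[OF u] AE_I2])
      show "norm (partial_deriv (1, 0) (u n) p) \<le> norm (gradient (u n) p)" for p
        using Basis_le_norm[OF e1_Basis, of "gradient (u n) p"] unfolding gradient_inner[OF e1_Basis] by simp
    qed
    then have "(L2_norm (slab L) (partial_deriv (1, 0) (u n)))\<^sup>2 \<le> (L2_norm (slab L) (gradient (u n)))\<^sup>2"
      by (rule power_mono[OF _ L2_norm_nonneg])
    then show ?thesis using poincare_smooth[OF u, of L n] by linarith
  qed
  show ?thesis
  proof (rule LIMSEQ_le)
    show "(\<lambda>n. (L2_norm (slab L) (u n))\<^sup>2) \<longlonglongrightarrow> (L2_norm (slab L) \<zeta>)\<^sup>2"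
      by (rule tendsto_power[OF L2_norm_tendsto[OF uL(1) L2s(1) lim(1)]])
    show "(\<lambda>n. (L2_norm (slab L) (gradient (u n)))\<^sup>2 + (L2_norm (slab_boundary L) (u n))\<^sup>2)
        \<longlonglongrightarrow> (L2_norm (slab L) ?G)\<^sup>2 + (L2_norm (slab_boundary L) ?\<tau>)\<^sup>2"
      by (rule tendsto_add[OF tendsto_power[OF L2_norm_tendsto[OF L2_gradient[OF u] L2s(2) lim(2)]]
            tendsto_power[OF L2_norm_tendsto[OF uL(2) L2s(3) lim(3)]]])
  qed (use le in blast)
qed

end
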